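(* Let $Z_p$, $\mathcal I_B$, $\mathfrak F$, and $\mathcal I(c)$ be as defined in the context, and assume that the non-zero sequence $c=(c_j)\in\ell^1$ satisfies $\#(\mathrm{supp}(c))\ge 2$. Then the following properties hold: (i) $\mathcal I(c)$ is a closed ideal of $\mathcal K(Z_p)$, as well as a left ideal of $\mathcal L(Z_p)$. (ii) $\mathcal I(c)$ is not a right ideal of $\mathcal L(Z_p)$, so that $\mathcal I(c)$ is a non-trivial closed $\mathcal K(Z_p)$-subideal of $\mathcal L(Z_p)$. (iii) $\mathcal I(c)\ne\mathcal I_B$ for any subset $\emptyset\ne B\subsetneq\mathbb N$. (iv) If $d\in\ell^1$ is a non-zero sequence such that $\mathrm{supp}(d)\ne\mathrm{supp}(c)$, then $\mathcal I(d)\neq\mathcal I(c)$. (v) Let $d\in\ell^1$ be a non-zero sequence. Then $\mathcal I(c)=\mathcal I(d)$ if and only if $c=\lambda d$ for some non-zero scalar $\lambda$. Hence the family $$\mathfrak F_+=\{\mathcal I(c): c\in\ell^1\text{ and }\#(\mathrm{supp}(c))\ge 2\}$$ consists of non-trivial closed $\mathcal K(Z_p)$-subideals of $\mathcal L(Z_p)$. The family $\mathfrak F_+$ has the size of the continuum, and $\mathfrak F_+\cap\mathfrak F=\emptyset$.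
   Context: Scalars are real or complex; $\mathbb N=\{1,2,\ldots\}$, $\mathbb N_0=\mathbb N\cup\{0\}$. For Banach spaces $E,F$: $\mathcal L(E,F)$, $\mathcal K(E,F)$ are the bounded, respectively compact, operators; $\mathcal A(E,F)$ is the operator-norm closure of the bounded finite-rank operators (the approximable operators); $\mathcal L(E)=\mathcal L(E,E)$, etc. A.P. is the approximation property. Subideals: for closed subalgebras $\mathcal J\subset\mathcal I\subset\mathcal B$ of a Banach algebra $\mathcal B$, $\mathcal J$ is a closed $\mathcal I$-subideal of $\mathcal B$ if $\mathcal I$ is an ideal of $\mathcal B$ and $\mathcal J$ is an ideal of $\mathcal I$; it is non-trivial if $\mathcal J$ is not an ideal of $\mathcal B$. The space $Z_p$: let $X$ be a Banach space such that $X$ has the A.P. but $X^*$ fails the A.P., and let $Y$ be a Banach space such that $\mathcal A(X,Y)\subsetneq\mathcal K(X,Y)$ (such a $Y$ exists). Fix $1<p<\infty$ and put $$Z_p=\Big(\bigoplus_{j=0}^\infty X_j\Big)_{\ell^p},\qquad X_0=Y,\quad X_j=X\ (j\ge1).$$ Let $P_j:Z_p\to X_j$ and $J_k:X_k\to Z_p$ be the natural projections and inclusions, and for $S\in\mathcal L(Z_p)$ write $S=[S_{jk}]$ with $S_{jk}=P_jSJ_k\in\mathcal L(X_k,X_j)$, $j,k\in\mathbb N_0$. For $\emptyset\ne B\subsetneq\mathbb N$ put $$\mathcal I_B=\{S=[S_{jk}]\in\mathcal K(Z_p): S_{00}\in\mathcal A(Y),\ S_{0k}\in\mathcal A(X,Y)\text{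 for }k\in B\},$$ and $\mathfrak F=\{\mathcal I_B:\emptyset\neq B\subsetneq\mathbb N\}$. For a non-zero sequence $c=(c_j)_{j\in\mathbb N}\in\ell^1$ let $\mathrm{supp}(c)=\{j\in\mathbb N:c_j\ne0\}$ and $$\mathcal I(c)=\Big\{S=[S_{jk}]\in\mathcal K(Z_p): S_{00}\in\mathcal A(Y)\text{ and } x\mapsto\sum_{r=1}^\infty c_rS_{0r}x\text{ is an approximable operator }X\to Y\Big\}.$$ (The series $\sum_r c_rS_{0r}$ converges absolutely in operator norm.) *)

theory Defs
  imports "HOL-Analysis.Analysis" "HOL-Library.Function_Algebras" "HOL-Library.Equipollence"
begin

text \<open>
  The scalar field is a type \<open>'k :: {real_normed_field, euclidean_space}\<close>. The types
  \<open>real\<close> and \<open>complex\<close> are of this sort, and up to isometric isomorphism there are no others.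

  The norm of the \<open>\<ell>\<^sup>p\<close>-sum depends on the real number \<open>p\<close>, so its points
  cannot form a type of class \<open>banach\<close>; that class would moreover only give real scalars.
  A normed space is therefore a structure: a subspace \<open>pts\<close> of an ambient vector
  space \<open>'a\<close>, with a norm that only matters on \<open>pts\<close>. Different spaces may live in the same
  ambient type, and two spaces over ambient types \<open>'a\<close> and \<open>'b\<close> can both be placed in
  \<open>'a \<times> 'b\<close>, so that taking a common ambient type for finitely many spaces is no restriction.
\<close>

record ('k, 'a) nspace =
  pts :: "'a set"
  smul :: "'k \<Rightarrow> 'a \<Rightarrow> 'a"
  nrm :: "'a \<Rightarrow> real"

locale normed_space = vector_space "smul E"
  for E :: "('k::{real_normed_field,euclidean_space}, 'a::ab_group_add) nspace" +
  assumes subspace_pts: "subspace (pts E)"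
    and nrm_nonneg: "x \<in> pts E \<Longrightarrow> 0 \<le> nrm E x"
    and nrm_eq_0: "x \<in> pts E \<Longrightarrow> nrm E x = 0 \<longleftrightarrow> x = 0"
    and nrm_triangle: "x \<in> pts E \<Longrightarrow> y \<in> pts E \<Longrightarrow> nrm E (x + y) \<le> nrm E x + nrm E y"
    and nrm_smul: "x \<in> pts E \<Longrightarrow> nrm E (smul E a x) = norm a * nrm E x"

text \<open>The value \<open>0\<close> outside \<open>pts E\<close> is needed because the locale \<open>Metric_space\<close> requires
  nonnegativity and symmetry on the whole type.\<close>

definition ndist :: "('k, 'a::ab_group_add) nspace \<Rightarrow> 'a \<Rightarrow> 'a \<Rightarrow> real" where
  "ndist E x y = (if x \<in> pts E \<and> y \<in> pts E then nrm E (x - y) else 0)"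

definition ntop :: "('k, 'a::ab_group_add) nspace \<Rightarrow> 'a topology" where
  "ntop E = Metric_space.mtopology (pts E) (ndist E)"

locale banach_space = normed_space E
  for E :: "('k::{real_normed_field,euclidean_space}, 'a::ab_group_add) nspace" +
  assumes complete: "Metric_space.mcomplete (pts E) (ndist E)"

definition nball :: "('k, 'a) nspace \<Rightarrow> 'a set" where
  "nball E = {x \<in> pts E. nrm E x \<le> 1}"


text \<open>Operators on \<open>E\<close> are total functions on the ambient type; they are extended by \<open>0\<close>
  outside \<open>pts E\<close>, so that equality of operators is equality of functions. This convention
  is preserved by pointwise linear combinations and by composition.\<close>

definition bounded_ops ::
  "('k, 'a::ab_group_add) nspace \<Rightarrow> ('k, 'b::ab_group_add) nspace \<Rightarrow> ('a \<Rightarrow> 'b) set" where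
  "bounded_ops E F = {T.
     (\<forall>x\<in>pts E. T x \<in> pts F) \<and>
     (\<forall>x\<in>pts E. \<forall>y\<in>pts E. T (x + y) = T x + T y) \<and>
     (\<forall>a. \<forall>x\<in>pts E. T (smul E a x) = smul F a (T x)) \<and>
     (\<exists>C. \<forall>x\<in>pts E. nrm F (T x) \<le> C * nrm E x) \<and>
     (\<forall>x. x \<notin> pts E \<longrightarrow> T x = 0)}"

definition op_space ::
  "('k, 'a::ab_group_add) nspace \<Rightarrow> ('k, 'b::ab_group_add) nspace \<Rightarrow> ('k, 'a \<Rightarrow> 'b) nspace" where
  "op_space E F = \<lparr>pts = bounded_ops E F,
                   smul = (\<lambda>a T x. smul F a (T x)),
                   nrm = (\<lambda>T. SUP x\<in>nball E. nrm F (T x))\<rparr>"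

definition compact_ops ::
  "('k, 'a::ab_group_add) nspace \<Rightarrow> ('k, 'b::ab_group_add) nspace \<Rightarrow> ('a \<Rightarrow> 'b) set" where
  "compact_ops E F =
     {T \<in> bounded_ops E F. compactin (ntop F) (ntop F closure_of (T ` nball E))}"

definition finite_rank_ops ::
  "('k::field, 'a::ab_group_add) nspace \<Rightarrow> ('k, 'b::ab_group_add) nspace \<Rightarrow> ('a \<Rightarrow> 'b) set" where
  "finite_rank_ops E F =
     {T \<in> bounded_ops E F. \<exists>B. finite B \<and> T ` pts E \<subseteq> module.span (smul F) B}"

definition approximable_ops ::
  "('k::field, 'a::ab_group_add) nspace \<Rightarrow> ('k, 'b::ab_group_add) nspace \<Rightarrow> ('a \<Rightarrow> 'b) set" where
  "approximable_ops E F = ntop (op_space E F) closure_of finite_rank_ops E F"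

definition approximation_property :: "('k::field, 'a::ab_group_add) nspace \<Rightarrow> bool" where
  "approximation_property E \<longleftrightarrow>
     (\<forall>K \<epsilon>. compactin (ntop E) K \<and> \<epsilon> > 0 \<longrightarrow>
        (\<exists>T\<in>finite_rank_ops E E. \<forall>x\<in>K. nrm E (T x - x) < \<epsilon>))"

definition scalar_space :: "('k::real_normed_field, 'k) nspace" where
  "scalar_space = \<lparr>pts = UNIV, smul = (*), nrm = norm\<rparr>"

definition dual_space ::
  "('k::real_normed_field, 'a::ab_group_add) nspace \<Rightarrow> ('k, 'a \<Rightarrow> 'k) nspace" where
  "dual_space E = op_space E scalar_space"


text \<open>Ideals and subalgebras, for sets of operators on \<open>E\<close> with composition as product.\<close>

definition op_subspace :: "('k::field, 'a::ab_group_add) nspace \<Rightarrow> ('a \<Rightarrow> 'a) set \<Rightarrow> bool" where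
  "op_subspace E J \<longleftrightarrow> J \<subseteq> bounded_ops E E \<and> module.subspace (smul (op_space E E)) J"

definition op_closed :: "('k, 'a::ab_group_add) nspace \<Rightarrow> ('a \<Rightarrow> 'a) set \<Rightarrow> bool" where
  "op_closed E J \<longleftrightarrow> closedin (ntop (op_space E E)) J"

definition left_ideal_of ::
  "('k::field, 'a::ab_group_add) nspace \<Rightarrow> ('a \<Rightarrow> 'a) set \<Rightarrow> ('a \<Rightarrow> 'a) set \<Rightarrow> bool" where
  "left_ideal_of E A J \<longleftrightarrow> J \<subseteq> A \<and> op_subspace E J \<and> (\<forall>U\<in>A. \<forall>S\<in>J. U \<circ> S \<in> J)"

definition right_ideal_of ::
  "('k::field, 'a::ab_group_add) nspace \<Rightarrow> ('a \<Rightarrow> 'a) set \<Rightarrow> ('a \<Rightarrow> 'a) set \<Rightarrow> bool" where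
  "right_ideal_of E A J \<longleftrightarrow> J \<subseteq> A \<and> op_subspace E J \<and> (\<forall>U\<in>A. \<forall>S\<in>J. S \<circ> U \<in> J)"

definition ideal_of ::
  "('k::field, 'a::ab_group_add) nspace \<Rightarrow> ('a \<Rightarrow> 'a) set \<Rightarrow> ('a \<Rightarrow> 'a) set \<Rightarrow> bool" where
  "ideal_of E A J \<longleftrightarrow> left_ideal_of E A J \<and> right_ideal_of E A J"

definition closed_subalgebra ::
  "('k::field, 'a::ab_group_add) nspace \<Rightarrow> ('a \<Rightarrow> 'a) set \<Rightarrow> bool" where
  "closed_subalgebra E J \<longleftrightarrow>
     op_subspace E J \<and> op_closed E J \<and> (\<forall>S\<in>J. \<forall>T\<in>J. S \<circ> T \<in> J)"

text \<open>\<open>J\<close> is a closed \<open>I\<close>-subideal of the algebra of all bounded operators on \<open>E\<close>.\<close>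

definition closed_subideal ::
  "('k::field, 'a::ab_group_add) nspace \<Rightarrow> ('a \<Rightarrow> 'a) set \<Rightarrow> ('a \<Rightarrow> 'a) set \<Rightarrow> bool" where
  "closed_subideal E I J \<longleftrightarrow>
     closed_subalgebra E I \<and> closed_subalgebra E J \<and> J \<subseteq> I \<and>
     ideal_of E (bounded_ops E E) I \<and> ideal_of E I J"

definition nontrivial_closed_subideal ::
  "('k::field, 'a::ab_group_add) nspace \<Rightarrow> ('a \<Rightarrow> 'a) set \<Rightarrow> ('a \<Rightarrow> 'a) set \<Rightarrow> bool" where
  "nontrivial_closed_subideal E I J \<longleftrightarrow>
     closed_subideal E I J \<and> \<not> ideal_of E (bounded_ops E E) J"


definition lp_sum :: "real \<Rightarrow> (nat \<Rightarrow> ('k, 'a) nspace) \<Rightarrow> ('k, nat \<Rightarrow> 'a) nspace" where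
  "lp_sum p E = \<lparr>pts = {z. (\<forall>j. z j \<in> pts (E j)) \<and> summable (\<lambda>j. nrm (E j) (z j) powr p)},
                 smul = (\<lambda>a z j. smul (E j) a (z j)),
                 nrm = (\<lambda>z. (\<Sum>j. nrm (E j) (z j) powr p) powr (1 / p))\<rparr>"

definition Zp :: "real \<Rightarrow> ('k, 'a) nspace \<Rightarrow> ('k, 'a) nspace \<Rightarrow> ('k, nat \<Rightarrow> 'a) nspace" where
  "Zp p X Y = lp_sum p (\<lambda>j. if j = 0 then Y else X)"

definition coord_proj :: "nat \<Rightarrow> (nat \<Rightarrow> 'a) \<Rightarrow> 'a" where
  "coord_proj j z = z j"

definition coord_incl :: "nat \<Rightarrow> 'a::zero \<Rightarrow> nat \<Rightarrow> 'a" where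
  "coord_incl k x = (\<lambda>j. if j = k then x else 0)"

text \<open>For \<open>S\<close> bounded on the sum of the spaces \<open>E\<^sub>j\<close>, the function \<open>entry S j k\<close> is again
  \<open>0\<close> outside \<open>pts (E k)\<close>, because \<open>coord_incl k\<close> maps the complement of \<open>pts (E k)\<close> to the
  complement of the sum.\<close>

definition entry :: "((nat \<Rightarrow> 'a::zero) \<Rightarrow> (nat \<Rightarrow> 'a)) \<Rightarrow> nat \<Rightarrow> nat \<Rightarrow> 'a \<Rightarrow> 'a" where
  "entry S j k = coord_proj j \<circ> S \<circ> coord_incl k"

definition ideal_B ::
  "real \<Rightarrow> ('k::field, 'a::ab_group_add) nspace \<Rightarrow> ('k, 'a) nspace \<Rightarrow> nat set \<Rightarrow>
     ((nat \<Rightarrow> 'a) \<Rightarrow> (nat \<Rightarrow> 'a)) set" where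
  "ideal_B p X Y B = {S \<in> compact_ops (Zp p X Y) (Zp p X Y).
     entry S 0 0 \<in> approximable_ops Y Y \<and> (\<forall>k\<in>B. entry S 0 k \<in> approximable_ops X Y)}"

definition family_F ::
  "real \<Rightarrow> ('k::field, 'a::ab_group_add) nspace \<Rightarrow> ('k, 'a) nspace \<Rightarrow>
     ((nat \<Rightarrow> 'a) \<Rightarrow> (nat \<Rightarrow> 'a)) set set" where
  "family_F p X Y = {ideal_B p X Y B | B. B \<noteq> {} \<and> B \<subset> {1..}}"

text \<open>Scalar sequences are indexed by \<open>{1, 2, \<dots>}\<close>; they are represented as functions on
  \<open>nat\<close> that vanish at \<open>0\<close>.\<close>

definition ell1 :: "(nat \<Rightarrow> 'k::real_normed_field) set" where
  "ell1 = {c. c 0 = 0 \<and> summable (\<lambda>j. norm (c j))}"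

definition supp :: "(nat \<Rightarrow> 'k::zero) \<Rightarrow> nat set" where
  "supp c = {j. 1 \<le> j \<and> c j \<noteq> 0}"

definition two_supported :: "(nat \<Rightarrow> 'k::zero) \<Rightarrow> bool" where
  "two_supported c \<longleftrightarrow> infinite (supp c) \<or> 2 \<le> card (supp c)"

definition nsums :: "('k, 'a::ab_group_add) nspace \<Rightarrow> (nat \<Rightarrow> 'a) \<Rightarrow> 'a \<Rightarrow> bool" where
  "nsums E f s \<longleftrightarrow> limitin (ntop E) (\<lambda>n. \<Sum>r=1..n. f r) s sequentially"

definition ideal_c ::
  "real \<Rightarrow> ('k::field, 'a::ab_group_add) nspace \<Rightarrow> ('k, 'a) nspace \<Rightarrow> (nat \<Rightarrow> 'k) \<Rightarrow>
     ((nat \<Rightarrow> 'a) \<Rightarrow> (nat \<Rightarrow> 'a)) set" where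
  "ideal_c p X Y c = {S \<in> compact_ops (Zp p X Y) (Zp p X Y).
     entry S 0 0 \<in> approximable_ops Y Y \<and>
     (\<exists>T\<in>approximable_ops X Y. \<forall>x\<in>pts X. nsums Y (\<lambda>r. smul Y (c r) (entry S 0 r x)) (T x))}"

definition family_F_plus ::
  "real \<Rightarrow> ('k::real_normed_field, 'a::ab_group_add) nspace \<Rightarrow> ('k, 'a) nspace \<Rightarrow>
     ((nat \<Rightarrow> 'a) \<Rightarrow> (nat \<Rightarrow> 'a)) set set" where
  "family_F_plus p X Y = {ideal_c p X Y c | c. c \<in> ell1 \<and> two_supported c}"

end

theory Submission
  imports Defs
begin

text \<open>
  Write \<open>J\<^sub>k\<close> and \<open>P\<^sub>j\<close> for the inclusions and projections of \<open>Z\<^sub>p\<close>, and \<open>D\<^sub>c : X \<rightarrow> Z\<^sub>p\<close> for the operator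
  \<open>x \<mapsto> (0, c\<^sub>1 x, c\<^sub>2 x, \<dots>)\<close>. Then \<open>\<Sum>\<^sub>r c\<^sub>r S\<^sub>0\<^sub>r = P\<^sub>0 S D\<^sub>c\<close>, so a compact operator \<open>S\<close> lies in
  \<open>\<I>(c)\<close> if and only if \<open>P\<^sub>0 S J\<^sub>0\<close> and \<open>P\<^sub>0 S D\<^sub>c\<close> are approximable.

  The projection \<open>P\<^sub>0\<close> can be dropped here. Since \<open>X\<close> has the approximation property, every compact
  operator into \<open>X\<close> is approximable (\<open>compact_imp_approximable\<close>). A compact operator into an
  \<open>\<ell>\<^sup>p\<close>-sum is the norm limit of its truncations to finitely many coordinates
  (\<open>compact_coordinatewise_approximable\<close>). Together: a compact operator into \<open>Z\<^sub>p\<close> is approximable as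
  soon as its zeroth coordinate is (\<open>approximable_iff_coord_0\<close>). Hence \<open>\<I>(c)\<close> consists of
  the compact \<open>S\<close> for which \<open>S J\<^sub>0\<close> and \<open>S D\<^sub>c\<close> are approximable (\<open>ideal_c_iff\<close>), a description that is
  visibly closed and stable under composition from the left with bounded operators. For a compact
  operator \<open>U\<close> on the right, \<open>S W\<close> is approximable for each compact \<open>W\<close> into \<open>Z\<^sub>p\<close>, because the part of \<open>W\<close>
  outside the zeroth coordinate is approximable and the remaining part factors through \<open>S J\<^sub>0\<close>
  (\<open>comp_compact_approximable\<close>).

  The remaining claims are linear algebra. Fix a compact \<open>T : X \<rightarrow> Y\<close> that is not approximable. The
  operator \<open>J\<^sub>0 T (a P\<^sub>r + b P\<^sub>s)\<close> is in \<open>\<I>(c)\<close> if and only if \<open>a c\<^sub>r + b c\<^sub>s = 0\<close>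
  (\<open>row_op_in_ideal_c_iff\<close>). Varying \<open>r, s, a, b\<close> recovers \<open>c\<close> up to a scalar
  (\<open>ideal_c_eq_iff\<close>). If \<open>r \<noteq> s\<close> lie in the support of \<open>c\<close>, the choice \<open>a = c\<^sub>s\<close>, \<open>b = - c\<^sub>r\<close> gives an
  element of \<open>\<I>(c)\<close> whose composition with \<open>J\<^sub>r P\<^sub>r\<close> is not in \<open>\<I>(c)\<close>
  (\<open>ideal_c_not_right_ideal\<close>), and none of whose entries at \<open>r\<close> and \<open>s\<close> is approximable, which no
  \<open>\<I>\<^sub>B\<close> can imitate (\<open>ideal_c_neq_ideal_B\<close>). The sequences \<open>(1, e\<^sup>t, 0, \<dots>)\<close> are pairwise not
  proportional, so there are at least as many ideals as reals; there are no more scalar sequences than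
  reals.
\<close>

section \<open>Normed spaces and their metric\<close>

context normed_space
begin

lemma pts_zero [simp]: "0 \<in> pts E"
  using subspace_pts by (rule subspace_0)

lemma pts_add: "x \<in> pts E \<Longrightarrow> y \<in> pts E \<Longrightarrow> x + y \<in> pts E"
  using subspace_pts by (rule subspace_add)

lemma pts_smul: "x \<in> pts E \<Longrightarrow> smul E a x \<in> pts E"
  using subspace_pts by (rule subspace_scale)

lemma pts_diff: "x \<in> pts E \<Longrightarrow> y \<in> pts E \<Longrightarrow> x - y \<in> pts E"
  using subspace_pts by (rule subspace_diff)

lemma nrm_zero [simp]: "nrm E 0 = 0"
  by (simp add: nrm_eq_0)

lemma nrm_minus: "x \<in> pts E \<Longrightarrow> nrm E (- x) = nrm E x"
  using nrm_smul[of x "-1"] by simp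

lemma nrm_diff_commute: "x \<in> pts E \<Longrightarrow> y \<in> pts E \<Longrightarrow> nrm E (x - y) = nrm E (y - x)"
  using nrm_minus[of "x - y"] pts_diff by simp

lemma nrm_triangle_diff:
  assumes "x \<in> pts E" "y \<in> pts E" "z \<in> pts E"
  shows "nrm E (x - z) \<le> nrm E (x - y) + nrm E (y - z)"
  using nrm_triangle[of "x - y" "y - z"] assms pts_diff by simp

lemma Metric_space_ndist: "Metric_space (pts E) (ndist E)"
proof
  fix x y z
  show "0 \<le> ndist E x y" by (simp add: ndist_def nrm_nonneg pts_diff)
  show "ndist E x y = ndist E y x" by (simp add: ndist_def nrm_diff_commute)
  show "x \<in> pts E \<Longrightarrow> y \<in> pts E \<Longrightarrow> (ndist E x y = 0) = (x = y)"
    by (simp add: ndist_def nrm_eq_0 pts_diff)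
  show "x \<in> pts E \<Longrightarrow> y \<in> pts E \<Longrightarrow> z \<in> pts E \<Longrightarrow> ndist E x z \<le> ndist E x y + ndist E y z"
    by (simp add: ndist_def nrm_triangle_diff)
qed

lemma zero_in_nball: "0 \<in> nball E"
  by (simp add: nball_def)

lemma topspace_ntop: "topspace (ntop E) = pts E"
  unfolding ntop_def by (rule Metric_space.topspace_mtopology[OF Metric_space_ndist])

lemma limitin_ntop:
  "limitin (ntop E) f l sequentially \<longleftrightarrow>
     l \<in> pts E \<and> (\<forall>e>0. \<exists>N. \<forall>n\<ge>N. f n \<in> pts E \<and> nrm E (f n - l) < e)"
  unfolding ntop_def Metric_space.limit_metric_sequentially[OF Metric_space_ndist]
  by (simp add: ndist_def cong: conj_cong)

lemma limitin_ntop_unique: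
  assumes "limitin (ntop E) f l sequentially" "limitin (ntop E) f l' sequentially"
  shows "l = l'"
  using assms Metric_space.limitin_metric_unique[OF Metric_space_ndist]
  unfolding ntop_def by (metis trivial_limit_sequentially)

end


section \<open>Bounded operators\<close>

lemma bounded_opsD:
  assumes "T \<in> bounded_ops E F"
  shows "x \<in> pts E \<Longrightarrow> T x \<in> pts F"
    and "x \<in> pts E \<Longrightarrow> y \<in> pts E \<Longrightarrow> T (x + y) = T x + T y"
    and "x \<in> pts E \<Longrightarrow> T (smul E a x) = smul F a (T x)"
    and "x \<notin> pts E \<Longrightarrow> T x = 0"
  using assms by (auto simp: bounded_ops_def)

lemma bounded_opsI:
  assumes "\<And>x. x \<in> pts E \<Longrightarrow> T x \<in> pts F"
    and "\<And>x y. x \<in> pts E \<Longrightarrow> y \<in> pts E \<Longrightarrow> T (x + y) = T x + T y"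
    and "\<And>a x. x \<in> pts E \<Longrightarrow> T (smul E a x) = smul F a (T x)"
    and "\<And>x. x \<in> pts E \<Longrightarrow> nrm F (T x) \<le> C * nrm E x"
    and "\<And>x. x \<notin> pts E \<Longrightarrow> T x = 0"
  shows "T \<in> bounded_ops E F"
  unfolding bounded_ops_def using assms by blast

lemma bounded_ops_eqI:
  assumes "S \<in> bounded_ops E F" "T \<in> bounded_ops E F" "\<And>x. x \<in> pts E \<Longrightarrow> S x = T x"
  shows "S = T"
  using assms bounded_opsD(4) by (metis ext)

lemma bounded_ops_bound:
  assumes "normed_space E" "T \<in> bounded_ops E F"
  obtains C where "C > 0" "\<And>x. x \<in> pts E \<Longrightarrow> nrm F (T x) \<le> C * nrm E x"
proof -
  interpret E: normed_space E by fact
  obtain C where C: "\<forall>x\<in>pts E. nrm F (T x) \<le> C * nrm E x"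
    using assms(2) by (auto simp: bounded_ops_def)
  have "nrm F (T x) \<le> max C 1 * nrm E x" if "x \<in> pts E" for x
    using C that mult_right_mono[OF max.cobounded1[of C 1] E.nrm_nonneg[OF that]] by fastforce
  then show thesis by (intro that[of "max C 1"]) auto
qed

lemma bounded_ops_zero: "normed_space E \<Longrightarrow> T \<in> bounded_ops E F \<Longrightarrow> T 0 = 0"
  using bounded_opsD(2)[of T E F 0 0] normed_space.pts_zero[of E] by simp

lemma bounded_ops_diff:
  assumes "normed_space E" "normed_space F" "T \<in> bounded_ops E F" "x \<in> pts E" "y \<in> pts E"
  shows "T (x - y) = T x - T y"
proof -
  interpret E: normed_space E by fact
  show ?thesis
    using bounded_opsD(2)[OF assms(3), of "x - y" y] assms(4,5) E.pts_diff by simp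
qed

lemma subspace_bounded_ops:
  assumes "normed_space E" "normed_space F"
  shows "0 \<in> bounded_ops E F"
    and "S \<in> bounded_ops E F \<Longrightarrow> T \<in> bounded_ops E F \<Longrightarrow> S + T \<in> bounded_ops E F"
    and "T \<in> bounded_ops E F \<Longrightarrow> (\<lambda>x. smul F a (T x)) \<in> bounded_ops E F"
proof -
  interpret E: normed_space E by fact
  interpret F: normed_space F by fact
  show "0 \<in> bounded_ops E F"
    by (rule bounded_opsI[where C = 0]) auto
  show "S + T \<in> bounded_ops E F" if S: "S \<in> bounded_ops E F" and T: "T \<in> bounded_ops E F"
  proof -
    obtain C where C: "\<And>x. x \<in> pts E \<Longrightarrow> nrm F (S x) \<le> C * nrm E x"
      using bounded_ops_bound[OF assms(1) S] by metis
    obtain D where D: "\<And>x. x \<in> pts E \<Longrightarrow> nrm F (T x) \<le> D * nrm E x"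
      using bounded_ops_bound[OF assms(1) T] by metis
    show ?thesis
    proof (rule bounded_opsI[where C = "C + D"])
      fix x assume x: "x \<in> pts E"
      have "nrm F (S x + T x) \<le> nrm F (S x) + nrm F (T x)"
        using F.nrm_triangle bounded_opsD(1)[OF S x] bounded_opsD(1)[OF T x] by blast
      then show "nrm F ((S + T) x) \<le> (C + D) * nrm E x"
        using C[OF x] D[OF x] by (simp add: distrib_right)
    qed (use bounded_opsD[OF S] bounded_opsD[OF T] in
          \<open>auto simp: F.pts_add F.scale_right_distrib\<close>)
  qed
  show "(\<lambda>x. smul F a (T x)) \<in> bounded_ops E F" if T: "T \<in> bounded_ops E F"
  proof -
    obtain C where C: "\<And>x. x \<in> pts E \<Longrightarrow> nrm F (T x) \<le> C * nrm E x"
      using bounded_ops_bound[OF assms(1) T] by metis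
    show ?thesis
    proof (rule bounded_opsI[where C = "norm a * C"])
      fix x assume x: "x \<in> pts E"
      show "nrm F (smul F a (T x)) \<le> norm a * C * nrm E x"
        using mult_left_mono[OF C[OF x], of "norm a"] bounded_opsD(1)[OF T x]
        by (simp add: F.nrm_smul mult.assoc)
    qed (use bounded_opsD[OF T] in
          \<open>auto simp: F.pts_smul F.scale_right_distrib F.scale_left_commute\<close>)
  qed
qed

lemma bounded_ops_minus:
  assumes "normed_space E" "normed_space F" "S \<in> bounded_ops E F" "T \<in> bounded_ops E F"
  shows "S - T \<in> bounded_ops E F"
proof -
  interpret F: normed_space F by fact
  have "S - T = S + (\<lambda>x. smul F (-1) (T x))" by (auto simp: fun_eq_iff)
  then show ?thesis using subspace_bounded_ops[OF assms(1,2)] assms(3,4) by metis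
qed

lemma bounded_ops_comp:
  assumes "normed_space E" "normed_space F" "S \<in> bounded_ops F G" "T \<in> bounded_ops E F"
  shows "S \<circ> T \<in> bounded_ops E G"
proof -
  interpret F: normed_space F by fact
  obtain C where "C > 0" and C: "\<And>x. x \<in> pts F \<Longrightarrow> nrm G (S x) \<le> C * nrm F x"
    using bounded_ops_bound[OF assms(2,3)] by metis
  obtain D where D: "\<And>x. x \<in> pts E \<Longrightarrow> nrm F (T x) \<le> D * nrm E x"
    using bounded_ops_bound[OF assms(1,4)] by metis
  show ?thesis
  proof (rule bounded_opsI[where C = "C * D"])
    fix x assume x: "x \<in> pts E"
    have "nrm G (S (T x)) \<le> C * nrm F (T x)"
      using C bounded_opsD(1)[OF assms(4) x] by blast
    also have "\<dots> \<le> C * (D * nrm E x)"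
      using D[OF x] \<open>C > 0\<close> by simp
    finally show "nrm G ((S \<circ> T) x) \<le> C * D * nrm E x" by (simp add: mult.assoc)
  qed (use bounded_opsD[OF assms(3)] bounded_opsD[OF assms(4)]
         bounded_ops_zero[OF assms(2,3)] in auto)
qed

text \<open>The operator norm enters only through estimates of the form
  \<open>\<parallel>T x\<parallel> \<le> e \<parallel>x\<parallel>\<close>, which compose without any mention of suprema.\<close>

lemma bound_on_nball_imp_bound:
  assumes "normed_space E" "normed_space F" "T \<in> bounded_ops E F"
    and "\<And>x. x \<in> nball E \<Longrightarrow> nrm F (T x) \<le> C" and "x \<in> pts E"
  shows "nrm F (T x) \<le> C * nrm E x"
proof (cases "x = 0")
  case True
  interpret E: normed_space E by fact
  interpret F: normed_space F by fact
  show ?thesis using True bounded_ops_zero[OF assms(1,3)] by simp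
next
  case False
  interpret E: normed_space E by fact
  interpret F: normed_space F by fact
  define r where "r = nrm E x"
  have r: "r > 0" using False E.nrm_nonneg E.nrm_eq_0 assms(5) r_def by (metis order_le_less)
  define y where "y = smul E (of_real (1 / r)) x"
  have y: "y \<in> pts E" by (simp add: y_def E.pts_smul assms(5))
  have "nrm E y = norm (of_real (1 / r) :: 'a) * r"
    unfolding y_def r_def by (rule E.nrm_smul[OF assms(5)])
  also have "\<dots> = 1" using r by (simp add: norm_divide)
  finally have "y \<in> nball E" using y by (simp add: nball_def)
  then have "nrm F (T y) \<le> C" by (rule assms(4))
  moreover have "x = smul E (of_real r) y"
    using r by (simp add: y_def flip: of_real_mult)
  then have "T x = smul F (of_real r) (T y)" using bounded_opsD(3)[OF assms(3) y] by simp
  then have "nrm F (T x) = r * nrm F (T y)"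
    using F.nrm_smul[OF bounded_opsD(1)[OF assms(3) y], of "of_real r"] r by simp
  ultimately show ?thesis using r by (simp add: r_def mult.commute)
qed

lemma op_norm_le_iff:
  assumes "normed_space E" "normed_space F" "T \<in> bounded_ops E F"
  shows "nrm (op_space E F) T \<le> C \<longleftrightarrow> (\<forall>x\<in>nball E. nrm F (T x) \<le> C)"
proof -
  interpret E: normed_space E by fact
  obtain D where D: "D > 0" "\<And>x. x \<in> pts E \<Longrightarrow> nrm F (T x) \<le> D * nrm E x"
    using bounded_ops_bound[OF assms(1,3)] by metis
  have "nrm F (T x) \<le> D" if "x \<in> nball E" for x
    using order_trans[OF D(2) mult_left_le[of "nrm E x" D]] that \<open>D > 0\<close> by (simp add: nball_def)
  then have "bdd_above ((\<lambda>x. nrm F (T x)) ` nball E)" by (rule bdd_aboveI2)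
  then show ?thesis
    unfolding op_space_def using E.zero_in_nball cSUP_le_iff[of "nball E" "\<lambda>x. nrm F (T x)" C]
    by (auto simp del: Sup_le_iff)
qed

lemma op_norm_le_iff_bound:
  assumes "normed_space E" "normed_space F" "T \<in> bounded_ops E F" "0 \<le> C"
  shows "nrm (op_space E F) T \<le> C \<longleftrightarrow> (\<forall>x\<in>pts E. nrm F (T x) \<le> C * nrm E x)"
proof
  show "nrm (op_space E F) T \<le> C \<Longrightarrow> \<forall>x\<in>pts E. nrm F (T x) \<le> C * nrm E x"
    using bound_on_nball_imp_bound[OF assms(1-3)] by (simp add: op_norm_le_iff[OF assms(1-3)])
next
  assume *: "\<forall>x\<in>pts E. nrm F (T x) \<le> C * nrm E x"
  have "nrm F (T x) \<le> C" if "x \<in> nball E" for x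
    using * that mult_left_mono[of "nrm E x" 1 C] assms(4) by (force simp: nball_def)
  then show "nrm (op_space E F) T \<le> C" by (simp add: op_norm_le_iff[OF assms(1-3)])
qed

lemma normed_space_op_space:
  assumes "normed_space E" "normed_space F"
  shows "normed_space (op_space E F)"
proof -
  interpret E: normed_space E by fact
  interpret F: normed_space F by fact
  have nonneg: "0 \<le> nrm (op_space E F) T" if "T \<in> bounded_ops E F" for T
  proof -
    have "nrm F (T 0) \<le> nrm (op_space E F) T"
      using op_norm_le_iff[OF assms that] E.zero_in_nball by blast
    then show ?thesis using bounded_ops_zero[OF assms(1) that] by simp
  qed
  have bd: "nrm F (T x) \<le> nrm (op_space E F) T * nrm E x"
    if "T \<in> bounded_ops E F" "x \<in> pts E" for T x
    using op_norm_le_iff_bound[OF assms that(1) nonneg[OF that(1)]] that(2) by blast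
  have scale_le: "nrm (op_space E F) (\<lambda>x. smul F a (T x)) \<le> norm a * nrm (op_space E F) T"
    if T: "T \<in> bounded_ops E F" for a T
  proof -
    have "nrm F (smul F a (T x)) \<le> (norm a * nrm (op_space E F) T) * nrm E x" if x: "x \<in> pts E" for x
      using F.nrm_smul[OF bounded_opsD(1)[OF T x], of a] mult_left_mono[OF bd[OF T x], of "norm a"]
      by (simp add: mult.assoc)
    then show ?thesis
      using op_norm_le_iff_bound[OF assms subspace_bounded_ops(3)[OF assms T]] nonneg[OF T]
      by (metis mult_nonneg_nonneg norm_ge_zero)
  qed
  have vs: "vector_space (smul (op_space E F))"
    by unfold_locales (auto simp: op_space_def fun_eq_iff F.scale_right_distrib F.scale_left_distrib)
  interpret V: vector_space "smul (op_space E F)" by (rule vs)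
  have pts: "pts (op_space E F) = bounded_ops E F" by (simp add: op_space_def)
  have smul: "smul (op_space E F) a T = (\<lambda>x. smul F a (T x))" for a T by (simp add: op_space_def)
  show ?thesis
  proof (intro normed_space.intro[OF vs] normed_space_axioms.intro, unfold pts)
    show "module.subspace (smul (op_space E F)) (bounded_ops E F)"
      using subspace_bounded_ops[OF assms] by (auto simp: V.subspace_def smul)
    fix T assume T: "T \<in> bounded_ops E F"
    show "0 \<le> nrm (op_space E F) T" by (rule nonneg[OF T])
    show "nrm (op_space E F) T = 0 \<longleftrightarrow> T = 0"
    proof
      assume "nrm (op_space E F) T = 0"
      then have "T x = 0" if "x \<in> pts E" for x
        using bd[OF T that] F.nrm_nonneg F.nrm_eq_0 bounded_opsD(1)[OF T that]
        by (metis mult_zero_left order_antisym)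
      then show "T = 0" using bounded_opsD(4)[OF T] by (metis ext zero_fun_apply)
    next
      assume "T = 0"
      then have "nrm (op_space E F) T \<le> 0" by (subst op_norm_le_iff[OF assms T]) auto
      with nonneg[OF T] show "nrm (op_space E F) T = 0" by simp
    qed
    fix S assume S: "S \<in> bounded_ops E F"
    have "nrm F ((T + S) x) \<le> (nrm (op_space E F) T + nrm (op_space E F) S) * nrm E x"
      if x: "x \<in> pts E" for x
    proof -
      have "nrm F ((T + S) x) \<le> nrm F (T x) + nrm F (S x)"
        using F.nrm_triangle[OF bounded_opsD(1)[OF T x] bounded_opsD(1)[OF S x]] by simp
      then show ?thesis using bd[OF T x] bd[OF S x] by (simp add: distrib_right)
    qed
    then show "nrm (op_space E F) (T + S) \<le> nrm (op_space E F) T + nrm (op_space E F) S"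
      using op_norm_le_iff_bound[OF assms subspace_bounded_ops(2)[OF assms T S]] nonneg[OF T] nonneg[OF S]
      by (metis add_nonneg_nonneg)
  next
    fix T a assume T: "T \<in> bounded_ops E F"
    have "nrm (op_space E F) (\<lambda>x. smul F a (T x)) = norm a * nrm (op_space E F) T"
    proof (cases "a = 0")
      case True
      then have "(\<lambda>x. smul F a (T x)) = 0" by auto
      then show ?thesis
        using scale_le[OF T, of a] True nonneg[OF subspace_bounded_ops(1)[OF assms]] by simp
    next
      case False
      let ?S = "\<lambda>x. smul F a (T x)"
      have "T = (\<lambda>x. smul F (inverse a) (?S x))" using False by simp
      then have "nrm (op_space E F) T \<le> norm (inverse a) * nrm (op_space E F) ?S"
        using scale_le[OF subspace_bounded_ops(3)[OF assms T], of "inverse a"] by metis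
      then have "norm a * nrm (op_space E F) T \<le> norm a * (norm (inverse a) * nrm (op_space E F) ?S)"
        by (rule mult_left_mono) simp
      also have "\<dots> = nrm (op_space E F) ?S"
        using False by (simp add: norm_inverse flip: mult.assoc)
      finally have "norm a * nrm (op_space E F) T \<le> nrm (op_space E F) ?S" .
      with scale_le[OF T, of a] show ?thesis by simp
    qed
    then show "nrm (op_space E F) (smul (op_space E F) a T) = norm a * nrm (op_space E F) T"
      by (simp only: smul)
  qed
qed

lemma closure_of_ops:
  assumes "normed_space E" "normed_space F" "J \<subseteq> bounded_ops E F"
  shows "T \<in> ntop (op_space E F) closure_of J \<longleftrightarrow>
    T \<in> bounded_ops E F \<and> (\<forall>e>0. \<exists>S\<in>J. \<forall>x\<in>pts E. nrm F (T x - S x) \<le> e * nrm E x)"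
proof -
  interpret O: normed_space "op_space E F" by (rule normed_space_op_space[OF assms(1,2)])
  have pts: "pts (op_space E F) = bounded_ops E F" by (simp add: op_space_def)
  have "S \<in> Metric_space.mcball (pts (op_space E F)) (ndist (op_space E F)) T e \<longleftrightarrow>
      (\<forall>x\<in>pts E. nrm F (T x - S x) \<le> e * nrm E x)"
    if "T \<in> bounded_ops E F" "S \<in> J" "e > 0" for S e
  proof -
    have "S \<in> bounded_ops E F" using that assms(3) by blast
    then show ?thesis
      using op_norm_le_iff_bound[OF assms(1,2) bounded_ops_minus[OF assms(1,2) that(1)], of S e] that
      by (simp add: Metric_space.in_mcball[OF O.Metric_space_ndist, unfolded pts] ndist_def pts)
  qed
  then show ?thesis
    unfolding ntop_def Metric_space.metric_closure_of_alt[OF O.Metric_space_ndist]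
    by (auto simp: pts)
qed

lemma op_closed_iff:
  assumes "normed_space E"
  shows "op_closed E J \<longleftrightarrow> J \<subseteq> bounded_ops E E \<and>
    (\<forall>T\<in>bounded_ops E E. (\<forall>e>0. \<exists>S\<in>J. \<forall>x\<in>pts E. nrm E (T x - S x) \<le> e * nrm E x) \<longrightarrow> T \<in> J)"
proof -
  interpret O: normed_space "op_space E E" by (rule normed_space_op_space[OF assms assms])
  show ?thesis
    unfolding op_closed_def closure_of_subset_eq[symmetric] O.topspace_ntop
    using closure_of_ops[OF assms assms, of J] by (auto simp: op_space_def)
qed



section \<open>Approximable and compact operators\<close>

definition scalar_op :: "('k, 'a::ab_group_add) nspace \<Rightarrow> 'k \<Rightarrow> 'a \<Rightarrow> 'a" where
  "scalar_op E a = (\<lambda>x. if x \<in> pts E then smul E a x else 0)"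

lemma scalar_op_bounded:
  assumes "normed_space E"
  shows "scalar_op E a \<in> bounded_ops E E"
proof -
  interpret E: normed_space E by fact
  show ?thesis
    by (rule bounded_opsI[where C = "norm a"])
      (auto simp: scalar_op_def E.pts_smul E.pts_add E.scale_right_distrib E.nrm_smul E.scale_left_commute)
qed

lemma scalar_op_comp:
  assumes "normed_space F" "T \<in> bounded_ops E F"
  shows "scalar_op F a \<circ> T = (\<lambda>x. smul F a (T x))"
proof
  fix x
  interpret F: normed_space F by fact
  show "(scalar_op F a \<circ> T) x = smul F a (T x)"
    using bounded_opsD[OF assms(2)] by (cases "x \<in> pts E") (auto simp: scalar_op_def)
qed

lemma finite_rank_bounded: "T \<in> finite_rank_ops E F \<Longrightarrow> T \<in> bounded_ops E F"
  by (simp add: finite_rank_ops_def)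

lemma finite_rank_add:
  assumes "normed_space E" "normed_space F" "S \<in> finite_rank_ops E F" "T \<in> finite_rank_ops E F"
  shows "S + T \<in> finite_rank_ops E F"
proof -
  interpret F: normed_space F by fact
  obtain A where A: "finite A" "S ` pts E \<subseteq> F.span A" using assms(3) by (auto simp: finite_rank_ops_def)
  obtain B where B: "finite B" "T ` pts E \<subseteq> F.span B" using assms(4) by (auto simp: finite_rank_ops_def)
  have "(S + T) ` pts E \<subseteq> F.span (A \<union> B)"
    using A(2) B(2) F.span_mono[of A "A \<union> B"] F.span_mono[of B "A \<union> B"]
    by (auto intro!: F.span_add)
  moreover have "S + T \<in> bounded_ops E F"
    using subspace_bounded_ops(2)[OF assms(1,2)] finite_rank_bounded assms(3,4) by metis
  moreover have "finite (A \<union> B)" using A(1) B(1) by simp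
  ultimately show ?thesis unfolding finite_rank_ops_def by blast
qed

lemma finite_rank_comp_right:
  assumes "normed_space E" "normed_space F" "S \<in> finite_rank_ops F G" "T \<in> bounded_ops E F"
  shows "S \<circ> T \<in> finite_rank_ops E G"
proof -
  have "S \<circ> T \<in> bounded_ops E G"
    using bounded_ops_comp[OF assms(1,2)] assms(3,4) finite_rank_bounded by blast
  moreover have "(S \<circ> T) ` pts E \<subseteq> S ` pts F" using bounded_opsD(1)[OF assms(4)] by auto
  ultimately show ?thesis using assms(3) unfolding finite_rank_ops_def by blast
qed

text \<open>A finite set that spans the range of \<open>T\<close> may leave the space on which \<open>S\<close> is linear. It
  is therefore replaced by a basis that consists of values of \<open>T\<close>.\<close>

lemma finite_rank_comp_left:
  assumes "normed_space E" "normed_space F" "normed_space G"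
    and "S \<in> bounded_ops F G" "T \<in> finite_rank_ops E F"
  shows "S \<circ> T \<in> finite_rank_ops E G"
proof -
  interpret F: normed_space F by fact
  interpret G: normed_space G by fact
  have T: "T \<in> bounded_ops E F" by (rule finite_rank_bounded[OF assms(5)])
  obtain A where A: "finite A" "T ` pts E \<subseteq> F.span A" using assms(5) by (auto simp: finite_rank_ops_def)
  obtain B where B: "B \<subseteq> T ` pts E" "F.independent B" "T ` pts E \<subseteq> F.span B"
    by (rule F.maximal_independent_subset)
  have "finite B" using F.independent_span_bound[OF A(1) B(2)] A(2) B(1) by blast
  have B_pts: "B \<subseteq> pts F" using B(1) bounded_opsD(1)[OF T] by auto
  have "x \<in> pts F \<and> S x \<in> G.span (S ` B)" if "x \<in> F.span B" for x
    using that
  proof (induction rule: F.span_induct_alt)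
    case base
    show ?case using bounded_ops_zero[OF assms(2,4)] G.span_zero by simp
  next
    case (step c x y)
    then have x: "x \<in> pts F" using B_pts by blast
    have "S (smul F c x + y) = smul G c (S x) + S y"
      using step x by (simp add: bounded_opsD[OF assms(4)] F.pts_smul)
    moreover have "smul G c (S x) + S y \<in> G.span (S ` B)"
      using step G.span_base[of "S x" "S ` B"] by (intro G.span_add G.span_scale) auto
    ultimately show ?case using step x by (simp add: F.pts_add F.pts_smul)
  qed
  then have "(S \<circ> T) ` pts E \<subseteq> G.span (S ` B)" using B(3) by auto
  then show ?thesis
    using \<open>finite B\<close> bounded_ops_comp[OF assms(1,2,4) T] unfolding finite_rank_ops_def by blast
qed

lemma approximable_iff:
  assumes "normed_space E" "normed_space F"
  shows "T \<in> approximable_ops E F \<longleftrightarrow> T \<in> bounded_ops E F \<and>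
    (\<forall>e>0. \<exists>S\<in>finite_rank_ops E F. \<forall>x\<in>pts E. nrm F (T x - S x) \<le> e * nrm E x)"
  unfolding approximable_ops_def
  by (rule closure_of_ops[OF assms]) (auto simp: finite_rank_ops_def)

lemma approximable_bounded:
  assumes "normed_space E" "normed_space F" "T \<in> approximable_ops E F"
  shows "T \<in> bounded_ops E F"
  using assms(3) unfolding approximable_iff[OF assms(1,2)] by blast

lemma approximable_limit:
  assumes "normed_space E" "normed_space F" "T \<in> bounded_ops E F"
    and "\<And>e. e > 0 \<Longrightarrow> \<exists>S\<in>approximable_ops E F. \<forall>x\<in>pts E. nrm F (T x - S x) \<le> e * nrm E x"
  shows "T \<in> approximable_ops E F"
proof -
  have fr: "finite_rank_ops E F \<subseteq> bounded_ops E F" by (auto simp: finite_rank_ops_def)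
  have ap: "approximable_ops E F \<subseteq> bounded_ops E F"
    using approximable_bounded[OF assms(1,2)] by blast
  have "T \<in> ntop (op_space E F) closure_of (approximable_ops E F)"
    unfolding closure_of_ops[OF assms(1,2) ap] using assms(3,4) by blast
  then show ?thesis by (simp add: approximable_ops_def)
qed

lemma finite_rank_zero:
  assumes "normed_space E" "normed_space F"
  shows "0 \<in> finite_rank_ops E F"
proof -
  interpret F: normed_space F by fact
  have "(0 :: 'b \<Rightarrow> 'c) ` pts E \<subseteq> F.span {}" by auto
  then show ?thesis
    using subspace_bounded_ops(1)[OF assms] unfolding finite_rank_ops_def by blast
qed

lemma approximable_zero:
  assumes "normed_space E" "normed_space F"
  shows "0 \<in> approximable_ops E F"
proof -
  interpret E: normed_space E by fact
  interpret F: normed_space F by fact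
  show ?thesis
    unfolding approximable_iff[OF assms]
    using finite_rank_zero[OF assms] subspace_bounded_ops(1)[OF assms]
    by (auto intro!: bexI[of _ 0] simp: E.nrm_nonneg)
qed

lemma approximable_add:
  assumes "normed_space E" "normed_space F" "S \<in> approximable_ops E F" "T \<in> approximable_ops E F"
  shows "S + T \<in> approximable_ops E F"
  unfolding approximable_iff[OF assms(1,2)]
proof (intro conjI allI impI)
  interpret F: normed_space F by fact
  note S = approximable_bounded[OF assms(1-3)]
  note T = approximable_bounded[OF assms(1,2,4)]
  show "S + T \<in> bounded_ops E F" using subspace_bounded_ops(2)[OF assms(1,2) S T] .
  fix e :: real assume "e > 0"
  then have e: "e / 2 > 0" by simp
  obtain S' where S': "S' \<in> finite_rank_ops E F" "\<And>x. x \<in> pts E \<Longrightarrow> nrm F (S x - S' x) \<le> e / 2 * nrm E x"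
    using assms(3) e unfolding approximable_iff[OF assms(1,2)] by blast
  obtain T' where T': "T' \<in> finite_rank_ops E F" "\<And>x. x \<in> pts E \<Longrightarrow> nrm F (T x - T' x) \<le> e / 2 * nrm E x"
    using assms(4) e unfolding approximable_iff[OF assms(1,2)] by blast
  have "nrm F ((S + T) x - (S' + T') x) \<le> e * nrm E x" if x: "x \<in> pts E" for x
  proof -
    have "nrm F ((S x - S' x) + (T x - T' x)) \<le> nrm F (S x - S' x) + nrm F (T x - T' x)"
      by (intro F.nrm_triangle F.pts_diff bounded_opsD(1)[OF S x] bounded_opsD(1)[OF T x]
          bounded_opsD(1)[OF finite_rank_bounded[OF S'(1)] x]
          bounded_opsD(1)[OF finite_rank_bounded[OF T'(1)] x])
    also have "\<dots> \<le> e * nrm E x" using S'(2)[OF x] T'(2)[OF x] by simp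
    finally show ?thesis by (simp add: algebra_simps)
  qed
  then show "\<exists>R\<in>finite_rank_ops E F. \<forall>x\<in>pts E. nrm F ((S + T) x - R x) \<le> e * nrm E x"
    using finite_rank_add[OF assms(1,2) S'(1) T'(1)] by blast
qed

lemma approximable_comp_left:
  assumes "normed_space E" "normed_space F" "normed_space G"
    and "S \<in> bounded_ops F G" "T \<in> approximable_ops E F"
  shows "S \<circ> T \<in> approximable_ops E G"
  unfolding approximable_iff[OF assms(1,3)]
proof (intro conjI allI impI)
  interpret F: normed_space F by fact
  note T = approximable_bounded[OF assms(1,2,5)]
  show "S \<circ> T \<in> bounded_ops E G" by (rule bounded_ops_comp[OF assms(1,2,4) T])
  fix e :: real assume e: "e > 0"
  obtain C where C: "C > 0" "\<And>x. x \<in> pts F \<Longrightarrow> nrm G (S x) \<le> C * nrm F x"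
    using bounded_ops_bound[OF assms(2,4)] by metis
  obtain R where R: "R \<in> finite_rank_ops E F" "\<And>x. x \<in> pts E \<Longrightarrow> nrm F (T x - R x) \<le> e / C * nrm E x"
    using assms(5) e C(1) unfolding approximable_iff[OF assms(1,2)] by (meson divide_pos_pos)
  have "nrm G ((S \<circ> T) x - (S \<circ> R) x) \<le> e * nrm E x" if x: "x \<in> pts E" for x
  proof -
    have TR: "T x \<in> pts F" "R x \<in> pts F"
      using bounded_opsD(1)[OF T x] bounded_opsD(1)[OF finite_rank_bounded[OF R(1)] x] by auto
    have "nrm G (S (T x) - S (R x)) \<le> C * nrm F (T x - R x)"
      using C(2)[OF F.pts_diff[OF TR]] bounded_ops_diff[OF assms(2-4) TR] by simp
    also have "\<dots> \<le> C * (e / C * nrm E x)" using R(2)[OF x] C(1) by (intro mult_left_mono) auto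
    finally show ?thesis using C(1) by simp
  qed
  then show "\<exists>Q\<in>finite_rank_ops E G. \<forall>x\<in>pts E. nrm G ((S \<circ> T) x - Q x) \<le> e * nrm E x"
    using finite_rank_comp_left[OF assms(1-4) R(1)] by blast
qed

lemma approximable_comp_right:
  assumes "normed_space E" "normed_space F" "normed_space G"
    and "S \<in> approximable_ops F G" "T \<in> bounded_ops E F"
  shows "S \<circ> T \<in> approximable_ops E G"
  unfolding approximable_iff[OF assms(1,3)]
proof (intro conjI allI impI)
  note S = approximable_bounded[OF assms(2,3,4)]
  show "S \<circ> T \<in> bounded_ops E G" by (rule bounded_ops_comp[OF assms(1,2) S assms(5)])
  fix e :: real assume e: "e > 0"
  obtain C where C: "C > 0" "\<And>x. x \<in> pts E \<Longrightarrow> nrm F (T x) \<le> C * nrm E x"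
    using bounded_ops_bound[OF assms(1,5)] by metis
  obtain R where R: "R \<in> finite_rank_ops F G" "\<And>x. x \<in> pts F \<Longrightarrow> nrm G (S x - R x) \<le> e / C * nrm F x"
    using assms(4) e C(1) unfolding approximable_iff[OF assms(2,3)] by (meson divide_pos_pos)
  have "nrm G ((S \<circ> T) x - (R \<circ> T) x) \<le> e * nrm E x" if x: "x \<in> pts E" for x
  proof -
    have "nrm G (S (T x) - R (T x)) \<le> e / C * nrm F (T x)"
      using R(2) bounded_opsD(1)[OF assms(5) x] by blast
    also have "\<dots> \<le> e / C * (C * nrm E x)" using C(2)[OF x] C(1) e by (intro mult_left_mono) auto
    finally show ?thesis using C(1) by simp
  qed
  then show "\<exists>Q\<in>finite_rank_ops E G. \<forall>x\<in>pts E. nrm G ((S \<circ> T) x - Q x) \<le> e * nrm E x"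
    using finite_rank_comp_right[OF assms(1,2) R(1) assms(5)] by blast
qed

lemma approximable_scale:
  assumes "normed_space E" "normed_space F" "T \<in> approximable_ops E F"
  shows "(\<lambda>x. smul F a (T x)) \<in> approximable_ops E F"
  using approximable_comp_left[OF assms(1,2,2) scalar_op_bounded[OF assms(2)] assms(3)]
    scalar_op_comp[OF assms(2) approximable_bounded[OF assms]] by simp

lemma (in normed_space) mtotally_bounded_iff_net:
  assumes "A \<subseteq> pts E"
  shows "Metric_space.mtotally_bounded (pts E) (ndist E) A \<longleftrightarrow>
    (\<forall>e>0. \<exists>N. finite N \<and> N \<subseteq> pts E \<and> (\<forall>x\<in>A. \<exists>y\<in>N. nrm E (x - y) < e))"
    (is "_ \<longleftrightarrow> ?net")
proof
  note ms = Metric_space_ndist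
  assume tb: "Metric_space.mtotally_bounded (pts E) (ndist E) A"
  show ?net
  proof (intro allI impI)
    fix e :: real assume "e > 0"
    then obtain N where N: "finite N" "N \<subseteq> A" "A \<subseteq> (\<Union>y\<in>N. Metric_space.mball (pts E) (ndist E) y e)"
      using tb unfolding Metric_space.mtotally_bounded_def[OF ms] by metis
    have "\<exists>y\<in>N. nrm E (x - y) < e" if x: "x \<in> A" for x
    proof -
      obtain y where y: "y \<in> N" "x \<in> Metric_space.mball (pts E) (ndist E) y e" using N(3) x by auto
      then have "nrm E (y - x) < e" "y \<in> pts E" "x \<in> pts E"
        by (auto simp: Metric_space.in_mball[OF ms] ndist_def)
      then show ?thesis using y(1) nrm_diff_commute by metis
    qed
    then show "\<exists>N. finite N \<and> N \<subseteq> pts E \<and> (\<forall>x\<in>A. \<exists>y\<in>N. nrm E (x - y) < e)"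
      using N(1,2) assms by (intro exI[of _ N]) auto
  qed
next
  note ms = Metric_space_ndist
  assume net: ?net
  show "Metric_space.mtotally_bounded (pts E) (ndist E) A"
    unfolding Metric_space.mtotally_bounded_def[OF ms]
  proof (intro allI impI)
    fix e :: real assume "e > 0"
    then have "e / 2 > 0" by simp
    then obtain N where N: "finite N" "N \<subseteq> pts E" "\<And>x. x \<in> A \<Longrightarrow> \<exists>y\<in>N. nrm E (x - y) < e / 2"
      using net by metis
    (* The net N need not lie in A; each of its points that is close to A is moved into A. *)
    define c where "c y = (SOME x. x \<in> A \<and> nrm E (x - y) < e / 2)" for y
    define M where "M = {y \<in> N. \<exists>x. x \<in> A \<and> nrm E (x - y) < e / 2}"
    have c: "c y \<in> A" "nrm E (c y - y) < e / 2" if "y \<in> M" for y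
      using someI_ex[of "\<lambda>x. x \<in> A \<and> nrm E (x - y) < e / 2"] that unfolding c_def M_def by auto
    have "x \<in> (\<Union>y\<in>c ` M. Metric_space.mball (pts E) (ndist E) y e)" if x: "x \<in> A" for x
    proof -
      obtain y where y: "y \<in> N" "nrm E (x - y) < e / 2" using N(3) x by blast
      then have M: "y \<in> M" using x by (auto simp: M_def)
      have pts: "c y \<in> pts E" "y \<in> pts E" "x \<in> pts E"
        using assms N(2) y(1) x c(1)[OF M] by auto
      have "nrm E (c y - x) \<le> nrm E (c y - y) + nrm E (y - x)"
        using pts by (rule nrm_triangle_diff)
      also have "\<dots> < e" using c(2)[OF M] y(2) nrm_diff_commute[OF pts(2,3)] by simp
      finally have "x \<in> Metric_space.mball (pts E) (ndist E) (c y) e"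
        using pts by (simp add: Metric_space.in_mball[OF ms] ndist_def)
      then show ?thesis using M by auto
    qed
    moreover have "finite (c ` M)" using N(1) by (simp add: M_def)
    moreover have "c ` M \<subseteq> A" using c(1) by auto
    ultimately show "\<exists>K. finite K \<and> K \<subseteq> A \<and>
        A \<subseteq> (\<Union>y\<in>K. Metric_space.mball (pts E) (ndist E) y e)"
      by (intro exI[of _ "c ` M"]) auto
  qed
qed

text \<open>In a complete space relative compactness is total boundedness, and finite nets, unlike
  compact closures, are easily carried along by operators and by limits.\<close>

lemma compact_ops_iff:
  assumes "normed_space E" "banach_space F"
  shows "T \<in> compact_ops E F \<longleftrightarrow> T \<in> bounded_ops E F \<and>
    (\<forall>e>0. \<exists>N. finite N \<and> N \<subseteq> pts F \<and> (\<forall>x\<in>nball E. \<exists>y\<in>N. nrm F (T x - y) < e))"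
proof (cases "T \<in> bounded_ops E F")
  case True
  interpret F: banach_space F by fact
  have im: "T ` nball E \<subseteq> pts F" using bounded_opsD(1)[OF True] by (auto simp: nball_def)
  have "compactin (ntop F) (ntop F closure_of (T ` nball E)) \<longleftrightarrow>
      Metric_space.mtotally_bounded (pts F) (ndist F) (T ` nball E)"
    unfolding ntop_def
    using Metric_space.mtotally_bounded_eq_compact_closure_of[OF F.Metric_space_ndist F.complete, of "T ` nball E"] im
    by simp
  then show ?thesis
    using True F.mtotally_bounded_iff_net[OF im] by (simp add: compact_ops_def)
qed (simp add: compact_ops_def)

lemma compact_bounded: "T \<in> compact_ops E F \<Longrightarrow> T \<in> bounded_ops E F"
  by (simp add: compact_ops_def)

lemma compact_ops_net:
  assumes "normed_space E" "banach_space F" "T \<in> compact_ops E F" "e > 0"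
  obtains N where "finite N" "N \<subseteq> pts F" "\<And>x. x \<in> nball E \<Longrightarrow> \<exists>y\<in>N. nrm F (T x - y) < e"
proof -
  have "\<exists>N. finite N \<and> N \<subseteq> pts F \<and> (\<forall>x\<in>nball E. \<exists>y\<in>N. nrm F (T x - y) < e)"
    using compact_ops_iff[OF assms(1,2), of T] assms(3,4) by simp
  then show thesis using that by auto
qed

lemma compact_zero:
  assumes "normed_space E" "banach_space F"
  shows "0 \<in> compact_ops E F"
proof -
  interpret F: banach_space F by fact
  show ?thesis
    unfolding compact_ops_iff[OF assms]
  proof (intro conjI allI impI)
    show "0 \<in> bounded_ops E F" by (rule subspace_bounded_ops(1)[OF assms(1) F.normed_space_axioms])
    fix e :: real assume "e > 0"
    then show "\<exists>N. finite N \<and> N \<subseteq> pts F \<and> (\<forall>x\<in>nball E. \<exists>y\<in>N. nrm F (0 x - y) < e)"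
      by (intro exI[of _ "{0}"]) simp
  qed
qed

lemma compact_add:
  assumes "normed_space E" "banach_space F" "S \<in> compact_ops E F" "T \<in> compact_ops E F"
  shows "S + T \<in> compact_ops E F"
  unfolding compact_ops_iff[OF assms(1,2)]
proof (intro conjI allI impI)
  interpret F: banach_space F by fact
  note S = compact_bounded[OF assms(3)] and T = compact_bounded[OF assms(4)]
  show "S + T \<in> bounded_ops E F"
    using subspace_bounded_ops(2)[OF assms(1) F.normed_space_axioms S T] .
  fix e :: real assume "e > 0"
  then have e: "e / 2 > 0" by simp
  obtain M where M: "finite M" "M \<subseteq> pts F" "\<And>x. x \<in> nball E \<Longrightarrow> \<exists>y\<in>M. nrm F (S x - y) < e / 2"
    using compact_ops_net[OF assms(1-3) e] by metis
  obtain N where N: "finite N" "N \<subseteq> pts F" "\<And>x. x \<in> nball E \<Longrightarrow> \<exists>y\<in>N. nrm F (T x - y) < e / 2"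
    using compact_ops_net[OF assms(1,2,4) e] by metis
  show "\<exists>N. finite N \<and> N \<subseteq> pts F \<and> (\<forall>x\<in>nball E. \<exists>y\<in>N. nrm F ((S + T) x - y) < e)"
  proof (intro exI conjI ballI)
    show "finite ((\<lambda>(u, v). u + v) ` (M \<times> N))" using M(1) N(1) by simp
    show "(\<lambda>(u, v). u + v) ` (M \<times> N) \<subseteq> pts F" using M(2) N(2) F.pts_add by auto
    fix x assume x: "x \<in> nball E"
    obtain u where u: "u \<in> M" "nrm F (S x - u) < e / 2" using M(3)[OF x] by blast
    obtain v where v: "v \<in> N" "nrm F (T x - v) < e / 2" using N(3)[OF x] by blast
    have "nrm F ((S x - u) + (T x - v)) \<le> nrm F (S x - u) + nrm F (T x - v)"
      using bounded_opsD(1)[OF S, of x] bounded_opsD(1)[OF T, of x] x u(1) v(1) M(2) N(2)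
      by (intro F.nrm_triangle F.pts_diff) (auto simp: nball_def)
    then have "nrm F ((S + T) x - (u + v)) < e" using u(2) v(2) by (simp add: algebra_simps)
    moreover have "u + v \<in> (\<lambda>(u, v). u + v) ` (M \<times> N)"
      using u(1) v(1) by (intro image_eqI[of _ _ "(u, v)"]) auto
    ultimately show "\<exists>y\<in>(\<lambda>(u, v). u + v) ` (M \<times> N). nrm F ((S + T) x - y) < e" by (rule bexI)
  qed
qed

lemma compact_comp_left:
  assumes "normed_space E" "banach_space F" "banach_space G"
    and "S \<in> bounded_ops F G" "T \<in> compact_ops E F"
  shows "S \<circ> T \<in> compact_ops E G"
  unfolding compact_ops_iff[OF assms(1,3)]
proof (intro conjI allI impI)
  interpret F: banach_space F by fact
  interpret G: banach_space G by fact
  note T = compact_bounded[OF assms(5)]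
  show "S \<circ> T \<in> bounded_ops E G" by (rule bounded_ops_comp[OF assms(1) F.normed_space_axioms assms(4) T])
  fix e :: real assume e: "e > 0"
  obtain C where C: "C > 0" "\<And>x. x \<in> pts F \<Longrightarrow> nrm G (S x) \<le> C * nrm F x"
    using bounded_ops_bound[OF F.normed_space_axioms assms(4)] by metis
  have "e / C > 0" using e C(1) by simp
  then obtain N where N: "finite N" "N \<subseteq> pts F" "\<And>x. x \<in> nball E \<Longrightarrow> \<exists>y\<in>N. nrm F (T x - y) < e / C"
    using compact_ops_net[OF assms(1,2,5)] by metis
  show "\<exists>N. finite N \<and> N \<subseteq> pts G \<and> (\<forall>x\<in>nball E. \<exists>y\<in>N. nrm G ((S \<circ> T) x - y) < e)"
  proof (intro exI conjI ballI)
    show "finite (S ` N)" using N(1) by simp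
    show "S ` N \<subseteq> pts G" using N(2) bounded_opsD(1)[OF assms(4)] by auto
    fix x assume x: "x \<in> nball E"
    obtain y where y: "y \<in> N" "nrm F (T x - y) < e / C" using N(3)[OF x] by blast
    have pts: "T x \<in> pts F" "y \<in> pts F"
      using bounded_opsD(1)[OF T, of x] x y(1) N(2) by (auto simp: nball_def)
    have "nrm G (S (T x) - S y) \<le> C * nrm F (T x - y)"
      using C(2)[OF F.pts_diff[OF pts]]
        bounded_ops_diff[OF F.normed_space_axioms G.normed_space_axioms assms(4) pts] by simp
    also have "\<dots> < e" using y(2) C(1) by (simp add: field_simps)
    finally show "\<exists>z\<in>S ` N. nrm G ((S \<circ> T) x - z) < e" using y(1) by auto
  qed
qed

lemma compact_comp_right:
  assumes "normed_space E" "normed_space F" "banach_space G"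
    and "S \<in> compact_ops F G" "T \<in> bounded_ops E F"
  shows "S \<circ> T \<in> compact_ops E G"
  unfolding compact_ops_iff[OF assms(1,3)]
proof (intro conjI allI impI)
  interpret F: normed_space F by fact
  interpret G: banach_space G by fact
  note S = compact_bounded[OF assms(4)]
  show "S \<circ> T \<in> bounded_ops E G" by (rule bounded_ops_comp[OF assms(1,2) S assms(5)])
  fix e :: real assume e: "e > 0"
  obtain C where C: "C > 0" "\<And>x. x \<in> pts E \<Longrightarrow> nrm F (T x) \<le> C * nrm E x"
    using bounded_ops_bound[OF assms(1,5)] by metis
  have "e / C > 0" using e C(1) by simp
  then obtain N where N: "finite N" "N \<subseteq> pts G" "\<And>x. x \<in> nball F \<Longrightarrow> \<exists>y\<in>N. nrm G (S x - y) < e / C"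
    using compact_ops_net[OF assms(2-4)] by metis
  show "\<exists>N. finite N \<and> N \<subseteq> pts G \<and> (\<forall>x\<in>nball E. \<exists>y\<in>N. nrm G ((S \<circ> T) x - y) < e)"
  proof (intro exI conjI ballI)
    show "finite (smul G (of_real C) ` N)" using N(1) by simp
    show "smul G (of_real C) ` N \<subseteq> pts G" using N(2) G.pts_smul by auto
    fix x assume "x \<in> nball E"
    then have x: "x \<in> pts E" "nrm E x \<le> 1" by (auto simp: nball_def)
    have Tx: "T x \<in> pts F" by (rule bounded_opsD(1)[OF assms(5) x(1)])
    define w where "w = smul F (of_real (1 / C)) (T x)"
    have w: "w \<in> pts F" by (simp add: w_def F.pts_smul Tx)
    have "nrm F (T x) \<le> C" using C(2)[OF x(1)] x(2) C(1) mult_left_le[of "nrm E x" C] by linarith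
    then have "w \<in> nball F"
      using w C(1) F.nrm_smul[OF Tx, of "of_real (1 / C)"] by (simp add: nball_def w_def norm_divide)
    then obtain y where y: "y \<in> N" "nrm G (S w - y) < e / C" using N(3) by blast
    have "T x = smul F (of_real C) w" using C(1) by (simp add: w_def flip: of_real_mult)
    then have "S (T x) = smul G (of_real C) (S w)" using bounded_opsD(3)[OF S w] by simp
    then have "S (T x) - smul G (of_real C) y = smul G (of_real C) (S w - y)"
      by (simp add: G.scale_right_diff_distrib)
    moreover have "S w - y \<in> pts G" using bounded_opsD(1)[OF S w] y(1) N(2) G.pts_diff by blast
    ultimately have "nrm G (S (T x) - smul G (of_real C) y) = C * nrm G (S w - y)"
      using G.nrm_smul[of "S w - y" "of_real C"] C(1) by simp
    also have "\<dots> < e" using y(2) C(1) by (simp add: field_simps)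
    finally show "\<exists>z\<in>smul G (of_real C) ` N. nrm G ((S \<circ> T) x - z) < e" using y(1) by auto
  qed
qed

lemma compact_scale:
  assumes "normed_space E" "banach_space F" "T \<in> compact_ops E F"
  shows "(\<lambda>x. smul F a (T x)) \<in> compact_ops E F"
proof -
  interpret F: banach_space F by fact
  show ?thesis
    using compact_comp_left[OF assms(1,2,2) scalar_op_bounded[OF F.normed_space_axioms] assms(3)]
      scalar_op_comp[OF F.normed_space_axioms compact_bounded[OF assms(3)]] by simp
qed

lemma compact_limit:
  assumes "normed_space E" "banach_space F" "T \<in> bounded_ops E F"
    and "\<And>e. e > 0 \<Longrightarrow> \<exists>S\<in>compact_ops E F. \<forall>x\<in>pts E. nrm F (T x - S x) \<le> e * nrm E x"
  shows "T \<in> compact_ops E F"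
  unfolding compact_ops_iff[OF assms(1,2)]
proof (intro conjI allI impI)
  interpret F: banach_space F by fact
  show "T \<in> bounded_ops E F" by fact
  fix e :: real assume "e > 0"
  then have e: "e / 2 > 0" by simp
  then obtain S where S: "S \<in> compact_ops E F" "\<And>x. x \<in> pts E \<Longrightarrow> nrm F (T x - S x) \<le> e / 2 * nrm E x"
    using assms(4) by metis
  obtain N where N: "finite N" "N \<subseteq> pts F" "\<And>x. x \<in> nball E \<Longrightarrow> \<exists>y\<in>N. nrm F (S x - y) < e / 2"
    using compact_ops_net[OF assms(1,2) S(1) e] by metis
  have "\<exists>y\<in>N. nrm F (T x - y) < e" if ball: "x \<in> nball E" for x
  proof -
    have x: "x \<in> pts E" "nrm E x \<le> 1" using ball by (auto simp: nball_def)
    obtain y where y: "y \<in> N" "nrm F (S x - y) < e / 2" using N(3)[OF ball] by metis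
    have "nrm F (T x - y) \<le> nrm F (T x - S x) + nrm F (S x - y)"
      using bounded_opsD(1)[OF assms(3) x(1)] bounded_opsD(1)[OF compact_bounded[OF S(1)] x(1)] y(1) N(2)
      by (intro F.nrm_triangle_diff) auto
    moreover have "nrm F (T x - S x) \<le> e / 2"
      using S(2)[OF x(1)] mult_left_le[of "nrm E x" "e / 2"] x(2) e by linarith
    ultimately show ?thesis using y by force
  qed
  then show "\<exists>N. finite N \<and> N \<subseteq> pts F \<and> (\<forall>x\<in>nball E. \<exists>y\<in>N. nrm F (T x - y) < e)"
    using N(1,2) by blast
qed

text \<open>The finite-rank operators that approximate the identity of \<open>F\<close> on the compact set
  \<open>closure (T (ball))\<close> turn \<open>T\<close> into a finite-rank operator close to \<open>T\<close>.\<close>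

lemma compact_imp_approximable:
  assumes "normed_space E" "banach_space F" "approximation_property F" "T \<in> compact_ops E F"
  shows "T \<in> approximable_ops E F"
proof -
  interpret F: banach_space F by fact
  have F: "normed_space F" by unfold_locales
  note T = compact_bounded[OF assms(4)]
  have im: "T ` nball E \<subseteq> pts F" using bounded_opsD(1)[OF T] by (auto simp: nball_def)
  define K where "K = ntop F closure_of (T ` nball E)"
  have "compactin (ntop F) K" using assms(4) by (simp add: compact_ops_def K_def)
  moreover have "T ` nball E \<subseteq> K"
    unfolding K_def using im by (intro closure_of_subset) (simp add: F.topspace_ntop)
  ultimately have near_id: "\<exists>R\<in>finite_rank_ops F F. \<forall>x\<in>nball E. nrm F (R (T x) - T x) < e"
    if "e > 0" for e
  proof -
    have "\<exists>R\<in>finite_rank_ops F F. \<forall>y\<in>K. nrm F (R y - y) < e"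
      using assms(3)[unfolded approximation_property_def, rule_format, of K e] \<open>compactin (ntop F) K\<close> that
      by simp
    then obtain R where "R \<in> finite_rank_ops F F" "\<forall>y\<in>K. nrm F (R y - y) < e" by metis
    then show ?thesis using \<open>T ` nball E \<subseteq> K\<close> by (intro bexI[of _ R]) auto
  qed
  show ?thesis
    unfolding approximable_iff[OF assms(1) F]
  proof (intro conjI allI impI)
    show "T \<in> bounded_ops E F" by (rule T)
    fix e :: real assume "e > 0"
    then obtain R where R: "R \<in> finite_rank_ops F F" "\<And>x. x \<in> nball E \<Longrightarrow> nrm F (R (T x) - T x) < e"
      using near_id by metis
    note RT = finite_rank_comp_right[OF assms(1) F R(1) T]
    have "nrm F (T x - (R \<circ> T) x) \<le> e" if "x \<in> nball E" for x
      using R(2)[OF that] that F.nrm_diff_commute[of "T x" "R (T x)"]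
        bounded_opsD(1)[OF T, of x] bounded_opsD(1)[OF finite_rank_bounded[OF R(1)], of "T x"]
      by (simp add: nball_def)
    then have "nrm F (T x - (R \<circ> T) x) \<le> e * nrm E x" if "x \<in> pts E" for x
      using bound_on_nball_imp_bound[OF assms(1) F bounded_ops_minus[OF assms(1) F T finite_rank_bounded[OF RT]]]
        that by simp
    then show "\<exists>S\<in>finite_rank_ops E F. \<forall>x\<in>pts E. nrm F (T x - S x) \<le> e * nrm E x"
      using RT by blast
  qed
qed



section \<open>Sums of Banach spaces in the sense of \<open>\<ell>\<^sup>p\<close>\<close>

lemma powr_convex_combination:
  fixes u v t p :: real
  assumes "1 \<le> p" "0 \<le> u" "0 \<le> v" "0 \<le> t" "t \<le> 1"
  shows "(t * u + (1 - t) * v) powr p \<le> t * u powr p + (1 - t) * v powr p"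
proof -
  have shrink: "(s * w) powr p \<le> s * w powr p" if "0 \<le> s" "s \<le> 1" "0 \<le> w" for s w :: real
  proof -
    have "s powr p \<le> s"
      using that assms(1) powr_mono'[of 1 p s] by (cases "s = 0") auto
    then show ?thesis using that by (simp add: powr_mult mult_right_mono)
  qed
  consider "u = 0" | "v = 0" | "u > 0" "v > 0" using assms by linarith
  then show ?thesis
  proof cases
    case 1
    then show ?thesis using shrink[of "1 - t" v] assms by simp
  next
    case 2
    then show ?thesis using shrink[of t u] assms by simp
  next
    case 3
    then show ?thesis
      using convex_onD[OF powr_convex[OF assms(1)], of "t" v u] assms
      by (simp add: add.commute)
  qed
qed

text \<open>Minkowski's inequality. The sum \<open>a + b\<close> is \<open>A + B\<close> times a convex combination of \<open>a / A\<close>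
  and \<open>b / B\<close>. Positive upper bounds \<open>A\<close> and \<open>B\<close> in place of the two norms avoid a separate
  treatment of sequences of norm \<open>0\<close>.\<close>

lemma minkowski_powr:
  fixes a b :: "nat \<Rightarrow> real"
  assumes p: "1 \<le> p" and nonneg: "\<And>j. 0 \<le> a j" "\<And>j. 0 \<le> b j"
    and summable: "summable (\<lambda>j. a j powr p)" "summable (\<lambda>j. b j powr p)"
    and le: "(\<Sum>j. a j powr p) \<le> A powr p" "(\<Sum>j. b j powr p) \<le> B powr p"
    and pos: "A > 0" "B > 0"
  shows "summable (\<lambda>j. (a j + b j) powr p)" and "(\<Sum>j. (a j + b j) powr p) \<le> (A + B) powr p"
proof -
  define t where "t = A / (A + B)"
  have t: "0 \<le> t" "t \<le> 1" "1 - t = B / (A + B)" using pos by (auto simp: t_def field_simps)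
  define g where "g j = (A + B) powr p * (t * (a j powr p / A powr p) + (1 - t) * (b j powr p / B powr p))" for j
  have bound: "(a j + b j) powr p \<le> g j" for j
  proof -
    have "a j + b j = (A + B) * (t * (a j / A) + (1 - t) * (b j / B))"
    proof -
      have "(A + B) * (t * (a j / A)) = a j" "(A + B) * ((1 - t) * (b j / B)) = b j"
        unfolding t(3) unfolding t_def using pos by simp_all
      then show ?thesis by (simp add: distrib_left)
    qed
    then have "(a j + b j) powr p = (A + B) powr p * (t * (a j / A) + (1 - t) * (b j / B)) powr p"
      using pos t nonneg by (simp add: powr_mult)
    also have "\<dots> \<le> (A + B) powr p * (t * (a j / A) powr p + (1 - t) * (b j / B) powr p)"
      using powr_convex_combination[OF p _ _ t(1,2), of "a j / A" "b j / B"] nonneg pos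
      by (intro mult_left_mono) auto
    also have "\<dots> = g j" using nonneg pos by (simp add: g_def powr_divide)
    finally show ?thesis .
  qed
  have sum_g: "summable g"
    unfolding g_def by (intro summable_mult summable_add summable_divide summable)
  show sum: "summable (\<lambda>j. (a j + b j) powr p)"
    by (rule summable_comparison_test'[OF sum_g, of 0]) (use bound in auto)
  have "(\<Sum>j. (a j + b j) powr p) \<le> (\<Sum>j. g j)" by (rule suminf_le[OF bound sum sum_g])
  also have "\<dots> = (A + B) powr p *
      (t * ((\<Sum>j. a j powr p) / A powr p) + (1 - t) * ((\<Sum>j. b j powr p) / B powr p))"
    unfolding g_def
    by (intro sums_unique[symmetric] sums_mult sums_add sums_divide summable_sums summable)
  also have "\<dots> \<le> (A + B) powr p * (t * 1 + (1 - t) * 1)"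
    using t le pos by (intro mult_left_mono add_mono) auto
  finally show "(\<Sum>j. (a j + b j) powr p) \<le> (A + B) powr p" by simp
qed

lemma (in normed_space) mcomplete_iff:
  "Metric_space.mcomplete (pts E) (ndist E) \<longleftrightarrow>
    (\<forall>s :: nat \<Rightarrow> 'a. (\<forall>n. s n \<in> pts E) \<and> (\<forall>e>0. \<exists>N. \<forall>n\<ge>N. \<forall>m\<ge>N. nrm E (s n - s m) < e) \<longrightarrow>
      (\<exists>l\<in>pts E. \<forall>e>0. \<exists>N. \<forall>n\<ge>N. nrm E (s n - l) < e))"
proof -
  note ms = Metric_space_ndist
  have 1: "Metric_space.MCauchy (pts E) (ndist E) s \<longleftrightarrow>
      (\<forall>n. s n \<in> pts E) \<and> (\<forall>e>0. \<exists>N. \<forall>n\<ge>N. \<forall>m\<ge>N. nrm E (s n - s m) < e)" for s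
  proof (cases "\<forall>n. s n \<in> pts E")
    case True
    then show ?thesis
      unfolding Metric_space.MCauchy_def[OF ms] by (simp add: ndist_def image_subset_iff)
  next
    case False
    then show ?thesis unfolding Metric_space.MCauchy_def[OF ms] by auto
  qed
  have 2: "limitin (Metric_space.mtopology (pts E) (ndist E)) s l sequentially \<longleftrightarrow>
      l \<in> pts E \<and> (\<forall>e>0. \<exists>N. \<forall>n\<ge>N. nrm E (s n - l) < e)" if "\<forall>n. s n \<in> pts E" for s l
    using limitin_ntop[of s l] that by (simp add: ntop_def)
  have "(Metric_space.MCauchy (pts E) (ndist E) s \<longrightarrow>
        (\<exists>l. limitin (Metric_space.mtopology (pts E) (ndist E)) s l sequentially)) \<longleftrightarrow>
      ((\<forall>n. s n \<in> pts E) \<and> (\<forall>e>0. \<exists>N. \<forall>n\<ge>N. \<forall>m\<ge>N. nrm E (s n - s m) < e) \<longrightarrow>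
        (\<exists>l\<in>pts E. \<forall>e>0. \<exists>N. \<forall>n\<ge>N. nrm E (s n - l) < e))" for s
  proof (cases "\<forall>n. s n \<in> pts E")
    case True
    show ?thesis unfolding 1 2[OF True] Bex_def by (rule refl)
  next
    case False
    then have "(\<forall>n. s n \<in> pts E) = False" by simp
    then show ?thesis unfolding 1 by (simp only: simp_thms)
  qed
  then show ?thesis unfolding Metric_space.mcomplete_def[OF ms] by (rule all_cong1)
qed

locale lp_direct_sum =
  fixes p :: real and E :: "nat \<Rightarrow> ('k::{real_normed_field,euclidean_space}, 'a::ab_group_add) nspace"
  assumes one_le_p: "1 \<le> p" and banach_summand: "banach_space (E j)"
begin

abbreviation (input) L where "L \<equiv> lp_sum p E"

lemma normed_summand: "normed_space (E j)"
  using banach_summand by (simp add: banach_space_def)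

interpretation summand: banach_space "E j" for j
  by (rule banach_summand)

lemma pts_lp_sum: "z \<in> pts L \<longleftrightarrow> (\<forall>j. z j \<in> pts (E j)) \<and> summable (\<lambda>j. nrm (E j) (z j) powr p)"
  by (simp add: lp_sum_def)

lemma pts_coord: "z \<in> pts L \<Longrightarrow> z j \<in> pts (E j)"
  by (simp add: pts_lp_sum)

lemma smul_lp_sum: "smul L a z j = smul (E j) a (z j)"
  by (simp add: lp_sum_def)

lemma nrm_lp_sum: "nrm L z = (\<Sum>j. nrm (E j) (z j) powr p) powr (1 / p)"
  by (simp add: lp_sum_def)

lemma nrm_lp_sum_powr:
  assumes "z \<in> pts L"
  shows "nrm L z powr p = (\<Sum>j. nrm (E j) (z j) powr p)"
proof -
  have "0 \<le> (\<Sum>j. nrm (E j) (z j) powr p)" using assms by (intro suminf_nonneg) (auto simp: pts_lp_sum)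
  then show ?thesis using one_le_p by (simp add: nrm_lp_sum powr_powr)
qed

lemma nrm_lp_sum_nonneg: "0 \<le> nrm L z"
  by (simp add: nrm_lp_sum)

lemma nrm_le_iff:
  assumes "z \<in> pts L" "0 \<le> C"
  shows "nrm L z \<le> C \<longleftrightarrow> (\<Sum>j. nrm (E j) (z j) powr p) \<le> C powr p"
  unfolding nrm_lp_sum_powr[OF assms(1), symmetric]
  using one_le_p assms(2) nrm_lp_sum_nonneg powr_mono2[of p "nrm L z" C] powr_less_mono2[of p C "nrm L z"]
  by (meson leD leI less_le_trans zero_less_one order_less_imp_le)

lemma lp_sum_dominated:
  assumes "z \<in> pts L" "\<And>j. w j \<in> pts (E j)" "\<And>j. nrm (E j) (w j) \<le> nrm (E j) (z j)"
  shows "w \<in> pts L" and "nrm L w \<le> nrm L z"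
proof -
  have le: "nrm (E j) (w j) powr p \<le> nrm (E j) (z j) powr p" for j
    using assms(2,3) one_le_p summand.nrm_nonneg by (intro powr_mono2) auto
  have z: "summable (\<lambda>j. nrm (E j) (z j) powr p)" using assms(1) by (simp add: pts_lp_sum)
  have w: "summable (\<lambda>j. nrm (E j) (w j) powr p)"
    by (rule summable_comparison_test'[OF z, of 0]) (use le in auto)
  then show "w \<in> pts L" using assms(2) by (simp add: pts_lp_sum)
  then have "nrm L w \<le> nrm L z \<longleftrightarrow> (\<Sum>j. nrm (E j) (w j) powr p) \<le> (\<Sum>j. nrm (E j) (z j) powr p)"
    using nrm_le_iff nrm_lp_sum_nonneg nrm_lp_sum_powr[OF assms(1)] by metis
  then show "nrm L w \<le> nrm L z" using suminf_le[OF le w z] by simp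
qed

lemma normed_space_lp_sum: "normed_space L"
proof -
  have vs: "vector_space (smul L)"
    by unfold_locales (auto simp: fun_eq_iff smul_lp_sum summand.scale_right_distrib summand.scale_left_distrib)
  interpret V: vector_space "smul L" by (rule vs)
  have add: "x + y \<in> pts L" "nrm L (x + y) \<le> nrm L x + nrm L y"
    if x: "x \<in> pts L" and y: "y \<in> pts L" for x y
  proof -
    have xy: "\<And>j. x j \<in> pts (E j)" "\<And>j. y j \<in> pts (E j)" using x y by (auto simp: pts_lp_sum)
    have approx: "x + y \<in> pts L \<and> nrm L (x + y) \<le> (nrm L x + e) + (nrm L y + e)" if e: "e > 0" for e
    proof -
      have pos: "nrm L x + e > 0" "nrm L y + e > 0"
        using e nrm_lp_sum_nonneg[of x] nrm_lp_sum_nonneg[of y] by linarith+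
      have "(\<Sum>j. nrm (E j) (x j) powr p) \<le> (nrm L x + e) powr p"
           "(\<Sum>j. nrm (E j) (y j) powr p) \<le> (nrm L y + e) powr p"
        using nrm_le_iff[OF x, of "nrm L x + e"] nrm_le_iff[OF y, of "nrm L y + e"] pos e by auto
      note M = minkowski_powr[OF one_le_p _ _ _ _ this pos]
      have sum: "summable (\<lambda>j. (nrm (E j) (x j) + nrm (E j) (y j)) powr p)"
        and le: "(\<Sum>j. (nrm (E j) (x j) + nrm (E j) (y j)) powr p) \<le> ((nrm L x + e) + (nrm L y + e)) powr p"
        using x y summand.nrm_nonneg[OF xy(1)] summand.nrm_nonneg[OF xy(2)]
        by (intro M; simp add: pts_lp_sum)+
      have termwise: "nrm (E j) (x j + y j) powr p \<le> (nrm (E j) (x j) + nrm (E j) (y j)) powr p" for j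
        using summand.nrm_triangle summand.nrm_nonneg summand.pts_add xy one_le_p by (intro powr_mono2) auto
      have sum': "summable (\<lambda>j. nrm (E j) (x j + y j) powr p)"
        by (rule summable_comparison_test'[OF sum, of 0]) (use termwise in auto)
      then have "x + y \<in> pts L" using summand.pts_add xy by (simp add: pts_lp_sum)
      moreover have "(\<Sum>j. nrm (E j) ((x + y) j) powr p) \<le> ((nrm L x + e) + (nrm L y + e)) powr p"
        using suminf_le[OF termwise sum' sum] le by simp
      ultimately show ?thesis using nrm_le_iff[of "x + y" "(nrm L x + e) + (nrm L y + e)"] pos by auto
    qed
    show "x + y \<in> pts L" using approx[of 1] by simp
    show "nrm L (x + y) \<le> nrm L x + nrm L y"
    proof (rule field_le_epsilon)
      fix e :: real assume "e > 0"
      then show "nrm L (x + y) \<le> nrm L x + nrm L y + e" using approx[of "e / 2"] by auto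
    qed
  qed
  have scale: "smul L a x \<in> pts L" "nrm L (smul L a x) = norm a * nrm L x" if x: "x \<in> pts L" for a x
  proof -
    have sum: "summable (\<lambda>j. nrm (E j) (x j) powr p)" using x by (simp add: pts_lp_sum)
    have eq: "nrm (E j) (smul L a x j) powr p = norm a powr p * nrm (E j) (x j) powr p" for j
      using x by (simp add: smul_lp_sum summand.nrm_smul pts_lp_sum powr_mult summand.nrm_nonneg)
    then have "summable (\<lambda>j. nrm (E j) (smul L a x j) powr p)" using sum by (simp add: summable_mult)
    then show "smul L a x \<in> pts L" using x by (simp add: pts_lp_sum smul_lp_sum summand.pts_smul)
    have "0 \<le> (\<Sum>j. nrm (E j) (x j) powr p)" by (rule suminf_nonneg[OF sum]) simp
    then show "nrm L (smul L a x) = norm a * nrm L x"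
      unfolding nrm_lp_sum eq suminf_mult[OF sum] using one_le_p by (simp add: powr_mult powr_powr)
  qed
  have zero: "0 \<in> pts L" using one_le_p by (simp add: pts_lp_sum)
  show ?thesis
  proof (intro normed_space.intro[OF vs] normed_space_axioms.intro)
    show "V.subspace (pts L)" using add scale zero by (auto simp: V.subspace_def)
    fix x assume x: "x \<in> pts L"
    show "0 \<le> nrm L x" by (rule nrm_lp_sum_nonneg)
    show "nrm L x = 0 \<longleftrightarrow> x = 0"
    proof -
      have sum: "summable (\<lambda>j. nrm (E j) (x j) powr p)" using x by (simp add: pts_lp_sum)
      have "nrm L x = 0 \<longleftrightarrow> (\<forall>j. nrm (E j) (x j) powr p = 0)"
        using suminf_eq_zero_iff[OF sum] by (simp add: nrm_lp_sum)
      also have "\<dots> \<longleftrightarrow> x = 0" using x by (auto simp: fun_eq_iff pts_lp_sum summand.nrm_eq_0)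
      finally show ?thesis .
    qed
    show "nrm L (smul L a x) = norm a * nrm L x" for a by (rule scale(2)[OF x])
    show "nrm L (x + y) \<le> nrm L x + nrm L y" if "y \<in> pts L" for y by (rule add(2)[OF x that])
  qed
qed

sublocale sum: normed_space "lp_sum p E"
  by (rule normed_space_lp_sum)

lemma nrm_coord_le:
  assumes "z \<in> pts L"
  shows "nrm (E j) (z j) \<le> nrm L z"
proof -
  have sum: "summable (\<lambda>j. nrm (E j) (z j) powr p)" using assms by (simp add: pts_lp_sum)
  have "nrm (E j) (z j) powr p \<le> nrm L z powr p"
    using sum_le_suminf[OF sum, of "{j}"] by (simp add: nrm_lp_sum_powr[OF assms])
  then show ?thesis
    using powr_less_mono2[of p "nrm L z" "nrm (E j) (z j)"] one_le_p nrm_lp_sum_nonneg[of z] by fastforce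
qed

text \<open>Convergence in every coordinate gives control of finite partial sums only. They suffice for
  membership and for the norm.\<close>

lemma lp_sum_partial_sums:
  assumes "\<And>j. w j \<in> pts (E j)" "0 \<le> C" "\<And>n. (\<Sum>j<n. nrm (E j) (w j) powr p) \<le> C powr p"
  shows "w \<in> pts L" and "nrm L w \<le> C"
proof -
  have sum: "summable (\<lambda>j. nrm (E j) (w j) powr p)"
    by (rule summableI_nonneg_bounded[OF _ assms(3)]) simp
  then show w: "w \<in> pts L" using assms(1) by (simp add: pts_lp_sum)
  show "nrm L w \<le> C" unfolding nrm_le_iff[OF w assms(2)] by (rule suminf_le_const[OF sum assms(3)])
qed

text \<open>A Cauchy sequence converges in each coordinate. The Cauchy estimate holds for every finite
  partial sum, survives the passage to the coordinatewise limit there, and so holds in the norm.\<close>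

lemma banach_space_lp_sum: "banach_space L"
proof (intro banach_space.intro[OF normed_space_lp_sum] banach_space_axioms.intro
    sum.mcomplete_iff[THEN iffD2] allI impI)
  fix s :: "nat \<Rightarrow> nat \<Rightarrow> 'a" assume "(\<forall>n. s n \<in> pts L) \<and> (\<forall>e>0. \<exists>N. \<forall>n\<ge>N. \<forall>m\<ge>N. nrm L (s n - s m) < e)"
  then have s: "\<forall>n. s n \<in> pts L"
    and cauchy: "\<forall>e>0. \<exists>N. \<forall>n\<ge>N. \<forall>m\<ge>N. nrm L (s n - s m) < e" by simp_all
  have s_pts: "s n j \<in> pts (E j)" for n j using s pts_coord by blast
  have "\<exists>l\<in>pts (E j). \<forall>e>0. \<exists>N. \<forall>n\<ge>N. nrm (E j) (s n j - l) < e" for j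
  proof -
    have "\<exists>N. \<forall>n\<ge>N. \<forall>m\<ge>N. nrm (E j) (s n j - s m j) < e" if "e > 0" for e
    proof -
      obtain N where N: "\<And>n m. n \<ge> N \<Longrightarrow> m \<ge> N \<Longrightarrow> nrm L (s n - s m) < e"
        using cauchy \<open>e > 0\<close> by metis
      have "nrm (E j) (s n j - s m j) < e" if "n \<ge> N" "m \<ge> N" for n m
        using nrm_coord_le[of "s n - s m" j] sum.pts_diff[of "s n" "s m"] s N[OF that] by fastforce
      then show ?thesis by blast
    qed
    then show ?thesis
      using summand.complete[of j] s_pts
      by (simp add: summand.mcomplete_iff)
  qed
  then obtain l where l: "\<And>j. l j \<in> pts (E j)" "\<And>j e. e > 0 \<Longrightarrow> \<exists>N. \<forall>n\<ge>N. nrm (E j) (s n j - l j) < e"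
    by metis
  have lim: "(\<lambda>m. nrm (E j) (s n j - s m j)) \<longlonglongrightarrow> nrm (E j) (s n j - l j)" for n j
  proof (rule LIMSEQ_I)
    fix e :: real assume "e > 0"
    then obtain N where N: "\<And>m. m \<ge> N \<Longrightarrow> nrm (E j) (s m j - l j) < e" using l(2) by metis
    have "\<bar>nrm (E j) (s n j - s m j) - nrm (E j) (s n j - l j)\<bar> \<le> nrm (E j) (s m j - l j)" for m
      using summand.nrm_triangle_diff[OF s_pts[of n j] s_pts[of m j] l(1)[of j]]
        summand.nrm_triangle_diff[OF s_pts[of n j] l(1)[of j] s_pts[of m j]]
        summand.nrm_diff_commute[OF s_pts[of m j] l(1)[of j]] by linarith
    then show "\<exists>N. \<forall>m\<ge>N. norm (nrm (E j) (s n j - s m j) - nrm (E j) (s n j - l j)) < e"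
      using N by (metis le_less_trans real_norm_def)
  qed
  have tail: "s n - l \<in> pts L \<and> nrm L (s n - l) \<le> e"
    if "e > 0" and N: "\<And>m. m \<ge> N \<Longrightarrow> nrm L (s n - s m) < e" for n N e
  proof -
    have "(\<Sum>j<J. nrm (E j) ((s n - l) j) powr p) \<le> e powr p" for J
    proof (rule LIMSEQ_le_const2)
      show "(\<lambda>m. \<Sum>j<J. nrm (E j) (s n j - s m j) powr p) \<longlonglongrightarrow> (\<Sum>j<J. nrm (E j) ((s n - l) j) powr p)"
        using lim one_le_p s_pts summand.nrm_nonneg summand.pts_diff
        by (auto intro!: tendsto_sum tendsto_powr2)
      have "(\<Sum>j<J. nrm (E j) (s n j - s m j) powr p) \<le> e powr p" if "m \<ge> N" for m
      proof -
        have d: "s n - s m \<in> pts L" using s sum.pts_diff by simp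
        then have "(\<Sum>j<J. nrm (E j) ((s n - s m) j) powr p) \<le> (\<Sum>j. nrm (E j) ((s n - s m) j) powr p)"
          by (intro sum_le_suminf) (auto simp: pts_lp_sum)
        also have "\<dots> \<le> e powr p" using nrm_le_iff[OF d, of e] N[OF \<open>m \<ge> N\<close>] \<open>e > 0\<close> by simp
        finally show ?thesis by simp
      qed
      then show "\<exists>N. \<forall>m\<ge>N. (\<Sum>j<J. nrm (E j) (s n j - s m j) powr p) \<le> e powr p" by blast
    qed
    moreover have "(s n - l) j \<in> pts (E j)" for j using s_pts l(1) summand.pts_diff by simp
    ultimately show ?thesis using lp_sum_partial_sums[of "s n - l" e] \<open>e > 0\<close> by auto
  qed
  obtain N where "\<And>n m. n \<ge> N \<Longrightarrow> m \<ge> N \<Longrightarrow> nrm L (s n - s m) < 1"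
    using cauchy zero_less_one by metis
  then have "s N - l \<in> pts L" using tail[of 1 N N] by simp
  then have "s N - (s N - l) \<in> pts L" using s by (simp only: sum.pts_diff)
  then have "l \<in> pts L" by simp
  moreover have "\<exists>N. \<forall>n\<ge>N. nrm L (s n - l) < e" if "e > 0" for e
  proof -
    have e2: "e / 2 > 0" using \<open>e > 0\<close> by simp
    then obtain N where "\<And>n m. n \<ge> N \<Longrightarrow> m \<ge> N \<Longrightarrow> nrm L (s n - s m) < e / 2"
      using cauchy by metis
    then have "nrm L (s n - l) < e" if "n \<ge> N" for n
      using tail[OF e2, of N n] that \<open>e > 0\<close> by fastforce
    then show ?thesis by blast
  qed
  ultimately show "\<exists>l\<in>pts L. \<forall>e>0. \<exists>N. \<forall>n\<ge>N. nrm L (s n - l) < e" by blast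
qed


text \<open>The inclusions and projections between the sum and its summands, extended by \<open>0\<close> as
  bounded operators are.\<close>

definition incl :: "nat \<Rightarrow> 'a \<Rightarrow> nat \<Rightarrow> 'a" where
  "incl k x = (if x \<in> pts (E k) then coord_incl k x else 0)"

definition proj :: "nat \<Rightarrow> (nat \<Rightarrow> 'a) \<Rightarrow> 'a" where
  "proj j z = (if z \<in> pts L then z j else 0)"

lemma incl_bounded: "incl k \<in> bounded_ops (E k) L"
proof (rule bounded_opsI[where C = 1])
  fix x assume x: "x \<in> pts (E k)"
  have "(\<Sum>j<n. nrm (E j) (coord_incl k x j) powr p) \<le> nrm (E k) x powr p" for n
  proof -
    have "(\<Sum>j<n. nrm (E j) (coord_incl k x j) powr p) = (\<Sum>j<n. if j = k then nrm (E k) x powr p else 0)"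
      using one_le_p by (intro sum.cong) (auto simp: coord_incl_def)
    also have "\<dots> \<le> nrm (E k) x powr p" by (simp add: sum.delta)
    finally show ?thesis .
  qed
  note b = lp_sum_partial_sums[OF _ summand.nrm_nonneg[OF x] this]
  show "incl k x \<in> pts L" "nrm L (incl k x) \<le> 1 * nrm (E k) x"
    using b x by (auto simp: incl_def coord_incl_def)
qed (auto simp: incl_def coord_incl_def summand.pts_add summand.pts_smul fun_eq_iff smul_lp_sum)

lemma proj_bounded: "proj j \<in> bounded_ops L (E j)"
  by (rule bounded_opsI[where C = 1])
    (auto simp: proj_def pts_coord nrm_coord_le sum.pts_add sum.pts_smul smul_lp_sum)

lemma entry_eq:
  assumes "S \<in> bounded_ops L L"
  shows "entry S j k = proj j \<circ> S \<circ> incl k"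
proof
  fix x
  show "entry S j k x = (proj j \<circ> S \<circ> incl k) x"
  proof (cases "x \<in> pts (E k)")
    case True
    then show ?thesis
      using bounded_opsD(1)[OF assms, of "incl k x"] bounded_opsD(1)[OF incl_bounded True]
      by (simp add: entry_def coord_proj_def proj_def incl_def)
  next
    case False
    then have "coord_incl k x \<notin> pts L" using pts_coord[of "coord_incl k x" k] by (auto simp: coord_incl_def)
    then show ?thesis
      using False bounded_opsD(4)[OF assms] bounded_ops_zero[OF normed_space_lp_sum assms]
      by (simp add: entry_def coord_proj_def proj_def incl_def)
  qed
qed

definition truncate :: "nat \<Rightarrow> (nat \<Rightarrow> 'a) \<Rightarrow> nat \<Rightarrow> 'a" where
  "truncate n z = (\<lambda>j. if j \<le> n then z j else 0)"

lemma truncate_pts: "z \<in> pts L \<Longrightarrow> truncate n z \<in> pts L"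
  by (rule lp_sum_dominated(1)) (auto simp: truncate_def pts_coord summand.nrm_nonneg)

lemma nrm_tail_le: "z \<in> pts L \<Longrightarrow> nrm L (z - truncate n z) \<le> nrm L z"
  by (rule lp_sum_dominated(2)) (auto simp: truncate_def pts_coord summand.nrm_nonneg)

lemma truncate_tendsto:
  assumes z: "z \<in> pts L" and "e > 0"
  obtains N where "\<And>n. n \<ge> N \<Longrightarrow> nrm L (z - truncate n z) < e"
proof -
  let ?f = "\<lambda>j. nrm (E j) (z j) powr p"
  have sum: "summable ?f" using z by (simp add: pts_lp_sum)
  have tail: "nrm L (z - truncate n z) powr p = suminf ?f - (\<Sum>j\<le>n. ?f j)" for n
  proof -
    have "(\<lambda>j. ?f j - (if j \<in> {..n} then ?f j else 0)) sums (suminf ?f - (\<Sum>j\<le>n. ?f j))"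
      by (intro sums_diff summable_sums[OF sum] sums_If_finite_set) simp
    moreover have "(\<lambda>j. ?f j - (if j \<in> {..n} then ?f j else 0)) = (\<lambda>j. nrm (E j) ((z - truncate n z) j) powr p)"
      using one_le_p by (auto simp: truncate_def)
    ultimately have "(\<lambda>j. nrm (E j) ((z - truncate n z) j) powr p) sums (suminf ?f - (\<Sum>j\<le>n. ?f j))"
      by (simp only:)
    then show ?thesis
      by (simp only: nrm_lp_sum_powr[OF sum.pts_diff[OF z truncate_pts[OF z]]] sums_iff)
  qed
  have "e powr p > 0" using \<open>e > 0\<close> by simp
  from LIMSEQ_D[OF summable_LIMSEQ'[OF sum] this]
  obtain N where N: "\<And>n. n \<ge> N \<Longrightarrow> norm ((\<Sum>j\<le>n. ?f j) - suminf ?f) < e powr p" by auto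
  have "nrm L (z - truncate n z) < e" if "n \<ge> N" for n
  proof (rule ccontr)
    assume "\<not> ?thesis"
    then have "e powr p \<le> nrm L (z - truncate n z) powr p" using \<open>e > 0\<close> one_le_p by (intro powr_mono2) auto
    then show False using N[OF \<open>n \<ge> N\<close>] by (simp add: tail abs_if split: if_splits)
  qed
  then show thesis by (rule that)
qed

text \<open>On a relatively compact set the truncations converge uniformly, so a compact operator into
  the sum is a norm limit of operators with finitely many nonzero coordinates.\<close>

lemma compact_coordinatewise_approximable:
  assumes F: "normed_space F" and T: "T \<in> compact_ops F L"
    and coord: "\<And>j. proj j \<circ> T \<in> approximable_ops F (E j)"
  shows "T \<in> approximable_ops F L"
proof (rule approximable_limit[OF F normed_space_lp_sum compact_bounded[OF T]])
  note Tb = compact_bounded[OF T]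
  have T_pts: "T x \<in> pts L" for x
    using bounded_opsD(1,4)[OF Tb, of x] sum.pts_zero by (cases "x \<in> pts F") auto
  have step: "incl k \<circ> (proj k \<circ> T) \<in> approximable_ops F L" for k
    by (rule approximable_comp_left[OF F normed_summand normed_space_lp_sum incl_bounded coord])
  have incl_proj: "(incl k \<circ> (proj k \<circ> T)) x = coord_incl k (T x k)" for k x
    using T_pts[of x] pts_coord by (simp add: incl_def proj_def)
  have trunc: "truncate n \<circ> T \<in> approximable_ops F L" for n
  proof (induction n)
    case 0
    have "truncate 0 \<circ> T = incl 0 \<circ> (proj 0 \<circ> T)"
      by (intro ext, subst incl_proj) (auto simp: truncate_def coord_incl_def fun_eq_iff)
    then show ?case using step[of 0] by (simp only:)
  next
    case (Suc n)
    have "truncate (Suc n) \<circ> T = (truncate n \<circ> T) + (incl (Suc n) \<circ> (proj (Suc n) \<circ> T))"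
      by (intro ext, subst plus_fun_apply, subst incl_proj)
        (auto simp: truncate_def coord_incl_def fun_eq_iff)
    then show ?case using approximable_add[OF F normed_space_lp_sum Suc step] by (simp only:)
  qed
  fix e :: real assume "e > 0"
  then have e: "e / 2 > 0" by simp
  obtain N where N: "finite N" "N \<subseteq> pts L" "\<And>x. x \<in> nball F \<Longrightarrow> \<exists>y\<in>N. nrm L (T x - y) < e / 2"
    using compact_ops_net[OF F banach_space_lp_sum T e] by metis
  have "\<exists>m. \<forall>n\<ge>m. nrm L (y - truncate n y) < e / 2" if "y \<in> N" for y
  proof -
    have "y \<in> pts L" using that N(2) by blast
    from truncate_tendsto[OF this e] show ?thesis by metis
  qed
  then obtain m where m: "\<And>y n. y \<in> N \<Longrightarrow> n \<ge> m y \<Longrightarrow> nrm L (y - truncate n y) < e / 2"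
    by metis
  define n where "n = (\<Sum>y\<in>N. m y)"
  have n: "nrm L (y - truncate n y) < e / 2" if "y \<in> N" for y
    using m[OF that] member_le_sum[of y N m] N(1) that by (simp add: n_def)
  have "nrm L (T x - (truncate n \<circ> T) x) \<le> e" if ball: "x \<in> nball F" for x
  proof -
    obtain y where y: "y \<in> N" "nrm L (T x - y) < e / 2" using N(3)[OF ball] by metis
    have y_pts: "y \<in> pts L" using y(1) N(2) by blast
    have d: "T x - y \<in> pts L" using sum.pts_diff T_pts y_pts by simp
    have "nrm L (((T x - y) - truncate n (T x - y)) + (y - truncate n y)) \<le>
        nrm L ((T x - y) - truncate n (T x - y)) + nrm L (y - truncate n y)"
      by (intro sum.nrm_triangle sum.pts_diff truncate_pts d y_pts T_pts)
    moreover have "((T x - y) - truncate n (T x - y)) + (y - truncate n y) = T x - truncate n (T x)"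
      by (auto simp: truncate_def fun_eq_iff)
    ultimately show ?thesis using nrm_tail_le[OF d, of n] y(2) n[OF y(1)] by simp
  qed
  then have "nrm L (T x - (truncate n \<circ> T) x) \<le> e * nrm F x" if "x \<in> pts F" for x
    using bound_on_nball_imp_bound[OF F normed_space_lp_sum
        bounded_ops_minus[OF F normed_space_lp_sum Tb approximable_bounded[OF F normed_space_lp_sum trunc]]]
      that by simp
  then show "\<exists>S\<in>approximable_ops F L. \<forall>x\<in>pts F. nrm L (T x - S x) \<le> e * nrm F x"
    using trunc by metis
qed

end



section \<open>Compact operators as a closed ideal\<close>

context banach_space
begin

interpretation ops: normed_space "op_space E E"
  by (rule normed_space_op_space) unfold_locales

lemma op_subspace_iff:
  "op_subspace E J \<longleftrightarrow> J \<subseteq> bounded_ops E E \<and> 0 \<in> J \<and> (\<forall>S\<in>J. \<forall>T\<in>J. S + T \<in> J) \<and>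
     (\<forall>a. \<forall>T\<in>J. (\<lambda>x. smul E a (T x)) \<in> J)"
  unfolding op_subspace_def ops.subspace_def by (simp add: op_space_def)

lemma compact_ops_ideal: "ideal_of E (bounded_ops E E) (compact_ops E E)"
proof -
  have b: "banach_space E" and n: "normed_space E" by unfold_locales
  show ?thesis
    unfolding ideal_of_def left_ideal_of_def right_ideal_of_def op_subspace_iff
    using compact_zero[OF n b] compact_add[OF n b] compact_scale[OF n b] compact_comp_left[OF n b b]
      compact_comp_right[OF n n b] compact_bounded by auto
qed

lemma closed_subalgebra_compact_ops: "closed_subalgebra E (compact_ops E E)"
proof -
  have b: "banach_space E" and n: "normed_space E" by unfold_locales
  have "op_closed E (compact_ops E E)"
    unfolding op_closed_iff[OF n]
  proof (intro conjI ballI impI)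
    fix T assume "T \<in> bounded_ops E E"
      and "\<forall>e>0. \<exists>S\<in>compact_ops E E. \<forall>x\<in>pts E. nrm E (T x - S x) \<le> e * nrm E x"
    then show "T \<in> compact_ops E E" by (intro compact_limit[OF n b]) simp_all
  qed (auto simp: compact_bounded)
  then show ?thesis
    using compact_ops_ideal compact_bounded
    unfolding closed_subalgebra_def ideal_of_def left_ideal_of_def by auto
qed

end


section \<open>The ideals \<open>\<I>(c)\<close>\<close>

locale zp_space =
  fixes X Y :: "('k::{real_normed_field,euclidean_space}, 'a::ab_group_add) nspace" and p :: real
  assumes banach_X: "banach_space X" and banach_Y: "banach_space Y"
    and ap_X: "approximation_property X" and one_le_exponent: "1 \<le> p"

sublocale zp_space \<subseteq> lp_direct_sum p "\<lambda>j. if j = 0 then Y else X"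
  by (rule lp_direct_sum.intro) (simp_all add: banach_X banach_Y one_le_exponent)

context zp_space
begin

lemma Zp_eq: "Zp p X Y = lp_sum p (\<lambda>j. if j = 0 then Y else X)"
  by (simp add: Zp_def)

interpretation X: banach_space X by (rule banach_X)
interpretation Y: banach_space Y by (rule banach_Y)
interpretation Z: banach_space "Zp p X Y"
  unfolding Zp_eq by (rule banach_space_lp_sum)

abbreviation (input) Z where "Z \<equiv> Zp p X Y"

lemma normed_X: "normed_space X" and normed_Y: "normed_space Y" and normed_Z: "normed_space Z"
  and banach_Z: "banach_space Z"
  by unfold_locales

lemma incl_0_bounded: "incl 0 \<in> bounded_ops Y Z"
  using incl_bounded[of 0] by (simp add: Zp_eq)

lemma incl_bounded_X: "k \<noteq> 0 \<Longrightarrow> incl k \<in> bounded_ops X Z"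
  using incl_bounded[of k] by (simp add: Zp_eq)

lemma proj_0_bounded: "proj 0 \<in> bounded_ops Z Y"
  using proj_bounded[of 0] by (simp add: Zp_eq)

lemma proj_bounded_X: "k \<noteq> 0 \<Longrightarrow> proj k \<in> bounded_ops Z X"
  using proj_bounded[of k] by (simp add: Zp_eq)

text \<open>All coordinates but the zeroth take values in \<open>X\<close>, where compact operators are
  approximable. So only the zeroth coordinate can obstruct approximability.\<close>

lemma approximable_iff_coord_0:
  assumes F: "normed_space F" and T: "T \<in> compact_ops F Z"
  shows "T \<in> approximable_ops F Z \<longleftrightarrow> proj 0 \<circ> T \<in> approximable_ops F Y"
proof
  show "T \<in> approximable_ops F Z \<Longrightarrow> proj 0 \<circ> T \<in> approximable_ops F Y"
    by (rule approximable_comp_left[OF F normed_Z normed_Y proj_0_bounded])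
next
  assume 0: "proj 0 \<circ> T \<in> approximable_ops F Y"
  have "proj j \<circ> T \<in> approximable_ops F (if j = 0 then Y else X)" for j
  proof (cases "j = 0")
    case False
    have "proj j \<circ> T \<in> compact_ops F X"
      by (rule compact_comp_left[OF F banach_Z banach_X proj_bounded_X[OF False] T])
    then show ?thesis using compact_imp_approximable[OF F banach_X ap_X] False by simp
  qed (use 0 in simp)
  then show "T \<in> approximable_ops F Z"
    using compact_coordinatewise_approximable[OF F] T by (simp add: Zp_eq)
qed

text \<open>Composition with the operator \<open>D\<^sub>c x = (0, c\<^sub>1 x, c\<^sub>2 x, \<dots>)\<close> turns the series
  \<open>\<Sum>\<^sub>r c\<^sub>r S\<^sub>0\<^sub>r\<close> into the single operator \<open>P\<^sub>0 S D\<^sub>c\<close>.\<close>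

definition spread :: "(nat \<Rightarrow> 'k) \<Rightarrow> 'a \<Rightarrow> nat \<Rightarrow> 'a" where
  "spread c x = (\<lambda>j. if x \<in> pts X then smul X (c j) x else 0)"

lemma spread_bounded:
  assumes c: "c \<in> ell1"
  shows "spread c \<in> bounded_ops X Z"
proof (rule bounded_opsI[where C = "\<Sum>j. norm (c j)"])
  have c0: "c 0 = 0" and sum: "summable (\<lambda>j. norm (c j))" using c by (auto simp: ell1_def)
  fix x assume x: "x \<in> pts X"
  define M where "M = (\<Sum>j. norm (c j))"
  have M: "M \<ge> 0" unfolding M_def by (rule suminf_nonneg[OF sum]) simp
  have part: "(\<Sum>j<n. norm (c j)) \<le> M" for n unfolding M_def by (rule sum_le_suminf[OF sum]) auto
  have coord: "norm (c j) powr p \<le> norm (c j) * M powr (p - 1)" for j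
  proof -
    have "norm (c j) \<le> M" using sum_le_suminf[OF sum, of "{j}"] by (simp add: M_def)
    then have "norm (c j) * norm (c j) powr (p - 1) \<le> norm (c j) * M powr (p - 1)"
      using one_le_exponent by (intro mult_left_mono powr_mono2) auto
    then show ?thesis by (simp add: powr_mult_base)
  qed
  have "(\<Sum>j<n. nrm (if j = 0 then Y else X) (spread c x j) powr p) \<le> (M * nrm X x) powr p" for n
  proof -
    have "(\<Sum>j<n. nrm (if j = 0 then Y else X) (spread c x j) powr p) =
        (\<Sum>j<n. norm (c j) powr p * nrm X x powr p)"
      using x one_le_exponent c0
      by (intro sum.cong) (auto simp: spread_def X.nrm_smul powr_mult X.nrm_nonneg)
    also have "\<dots> \<le> (\<Sum>j<n. norm (c j) * M powr (p - 1) * nrm X x powr p)"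
      by (intro sum_mono mult_right_mono coord) simp
    also have "\<dots> = (\<Sum>j<n. norm (c j)) * (M powr (p - 1) * nrm X x powr p)"
      by (simp add: sum_distrib_right mult.assoc)
    also have "\<dots> \<le> M * (M powr (p - 1) * nrm X x powr p)"
      by (intro mult_right_mono part) simp
    also have "\<dots> = (M * nrm X x) powr p"
      using M by (simp add: powr_mult_base powr_mult X.nrm_nonneg[OF x] flip: mult.assoc)
    finally show ?thesis .
  qed
  note b = lp_sum_partial_sums[OF _ mult_nonneg_nonneg[OF M X.nrm_nonneg[OF x]] this]
  have pts: "spread c x j \<in> pts (if j = 0 then Y else X)" for j
    using x c0 by (simp add: spread_def X.pts_smul)
  show "spread c x \<in> pts Z" using b(1)[OF pts] by (simp add: Zp_eq)
  show "nrm Z (spread c x) \<le> (\<Sum>j. norm (c j)) * nrm X x"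
    using b(2)[OF pts] by (simp add: Zp_eq M_def)
next
  have c0: "c 0 = 0" using c by (simp add: ell1_def)
  show "spread c (smul X a x) = smul Z a (spread c x)" if "x \<in> pts X" for a x
    using that c0 by (auto simp: spread_def fun_eq_iff Zp_eq smul_lp_sum X.pts_smul mult.commute)
qed (auto simp: spread_def fun_eq_iff X.pts_add X.scale_right_distrib)

lemma row_series_sums:
  assumes c: "c \<in> ell1" and S: "S \<in> bounded_ops Z Z" and x: "x \<in> pts X"
  shows "nsums Y (\<lambda>r. smul Y (c r) (entry S 0 r x)) (proj 0 (S (spread c x)))"
proof -
  let ?R = "proj 0 \<circ> S" and ?z = "spread c x"
  have R: "?R \<in> bounded_ops Z Y" by (rule bounded_ops_comp[OF normed_Z normed_Z proj_0_bounded S])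
  have z: "?z \<in> pts Z" by (rule bounded_opsD(1)[OF spread_bounded[OF c] x])
  have tz: "truncate n ?z \<in> pts Z" for n using truncate_pts z by (simp add: Zp_eq)
  have partial: "(\<Sum>r=1..n. smul Y (c r) (entry S 0 r x)) = ?R (truncate n ?z)" for n
  proof (induction n)
    case 0
    have "truncate 0 ?z = 0" using c by (auto simp: truncate_def spread_def ell1_def fun_eq_iff)
    then have "?R (truncate 0 ?z) = 0" using bounded_ops_zero[OF normed_Z R] by (simp only:)
    then show ?case by simp
  next
    case (Suc n)
    let ?k = "Suc n"
    have i: "incl ?k \<in> bounded_ops X Z" by (rule incl_bounded_X) simp
    have "entry S 0 ?k x = ?R (incl ?k x)"
      using entry_eq[of S 0 ?k] S by (simp add: Zp_eq)
    then have "smul Y (c ?k) (entry S 0 ?k x) = ?R (incl ?k (smul X (c ?k) x))"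
      using bounded_opsD(3)[OF R bounded_opsD(1)[OF i x]] bounded_opsD(3)[OF i x] by simp
    moreover have "truncate ?k ?z = truncate n ?z + incl ?k (smul X (c ?k) x)"
      using x X.pts_smul[OF x]
      by (auto simp: truncate_def incl_def coord_incl_def spread_def fun_eq_iff)
    moreover have "incl ?k (smul X (c ?k) x) \<in> pts Z"
      by (rule bounded_opsD(1)[OF i X.pts_smul[OF x]])
    ultimately have "?R (truncate n ?z) + smul Y (c ?k) (entry S 0 ?k x) = ?R (truncate ?k ?z)"
      using bounded_opsD(2)[OF R tz[of n]] by (simp only:)
    then show ?case using Suc by simp
  qed
  obtain C where C: "C > 0" "\<And>w. w \<in> pts Z \<Longrightarrow> nrm Y (?R w) \<le> C * nrm Z w"
    using bounded_ops_bound[OF normed_Z R] by metis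
  have "\<exists>N. \<forall>n\<ge>N. nrm Y (?R (truncate n ?z) - ?R ?z) < e" if "e > 0" for e
  proof -
    have "e / C > 0" using that C(1) by simp
    then obtain N where N: "\<And>n. n \<ge> N \<Longrightarrow> nrm Z (?z - truncate n ?z) < e / C"
      using truncate_tendsto[of ?z "e / C"] z unfolding Zp_eq by metis
    have "nrm Y (?R (truncate n ?z) - ?R ?z) < e" if "n \<ge> N" for n
    proof -
      have "nrm Y (?R (truncate n ?z - ?z)) \<le> C * nrm Z (truncate n ?z - ?z)"
        by (rule C(2)[OF Z.pts_diff[OF tz z]])
      also have "\<dots> < e" using N[OF that] C(1) Z.nrm_diff_commute[OF tz z] by (simp add: field_simps)
      finally show ?thesis using bounded_ops_diff[OF normed_Z normed_Y R tz z] by simp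
    qed
    then show ?thesis by blast
  qed
  then show ?thesis
    unfolding nsums_def Y.limitin_ntop partial
    using bounded_opsD(1)[OF R tz] bounded_opsD(1)[OF R z] by simp
qed

text \<open>The limit of a series is unique, so the operator in the definition of \<open>\<I>(c)\<close> can only be
  \<open>P\<^sub>0 S D\<^sub>c\<close>.\<close>

lemma ideal_c_iff_row:
  assumes c: "c \<in> ell1"
  shows "S \<in> ideal_c p X Y c \<longleftrightarrow> S \<in> compact_ops Z Z \<and>
    proj 0 \<circ> (S \<circ> incl 0) \<in> approximable_ops Y Y \<and> proj 0 \<circ> (S \<circ> spread c) \<in> approximable_ops X Y"
proof (cases "S \<in> compact_ops Z Z")
  case True
  note S = compact_bounded[OF True]
  let ?R = "proj 0 \<circ> (S \<circ> spread c)"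
  have R: "?R \<in> bounded_ops X Y"
    by (intro bounded_ops_comp[OF normed_X normed_Z] proj_0_bounded S spread_bounded c normed_Z)
  have sums: "nsums Y (\<lambda>r. smul Y (c r) (entry S 0 r x)) (?R x)" if "x \<in> pts X" for x
    using row_series_sums[OF c S that] by simp
  have "(\<exists>T\<in>approximable_ops X Y. \<forall>x\<in>pts X. nsums Y (\<lambda>r. smul Y (c r) (entry S 0 r x)) (T x)) \<longleftrightarrow>
      ?R \<in> approximable_ops X Y"
  proof
    assume "\<exists>T\<in>approximable_ops X Y. \<forall>x\<in>pts X. nsums Y (\<lambda>r. smul Y (c r) (entry S 0 r x)) (T x)"
    then obtain T where T: "T \<in> approximable_ops X Y"
      "\<And>x. x \<in> pts X \<Longrightarrow> nsums Y (\<lambda>r. smul Y (c r) (entry S 0 r x)) (T x)" by auto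
    have "T x = ?R x" if "x \<in> pts X" for x
      using T(2)[OF that] sums[OF that] unfolding nsums_def by (rule Y.limitin_ntop_unique)
    then have "T = ?R"
      by (rule bounded_ops_eqI[OF approximable_bounded[OF normed_X normed_Y T(1)] R])
    then show "?R \<in> approximable_ops X Y" using T(1) by (simp only:)
  next
    assume "?R \<in> approximable_ops X Y"
    then show "\<exists>T\<in>approximable_ops X Y. \<forall>x\<in>pts X. nsums Y (\<lambda>r. smul Y (c r) (entry S 0 r x)) (T x)"
      using sums by (intro bexI[of _ ?R]) auto
  qed
  moreover have "entry S 0 0 = proj 0 \<circ> (S \<circ> incl 0)"
    using entry_eq[of S 0 0] S by (simp add: Zp_eq comp_assoc)
  ultimately show ?thesis using True by (simp add: ideal_c_def)
qed (simp add: ideal_c_def)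

text \<open>In this form closedness and the left ideal property are immediate, because both conditions
  on \<open>S\<close> only involve composition from the right.\<close>

lemma ideal_c_iff:
  assumes c: "c \<in> ell1"
  shows "S \<in> ideal_c p X Y c \<longleftrightarrow> S \<in> compact_ops Z Z \<and>
    S \<circ> incl 0 \<in> approximable_ops Y Z \<and> S \<circ> spread c \<in> approximable_ops X Z"
proof (cases "S \<in> compact_ops Z Z")
  case True
  show ?thesis
    unfolding ideal_c_iff_row[OF c]
      approximable_iff_coord_0[OF normed_Y compact_comp_right[OF normed_Y normed_Z banach_Z True incl_0_bounded]]
      approximable_iff_coord_0[OF normed_X compact_comp_right[OF normed_X normed_Z banach_Z True spread_bounded[OF c]]]
    by (rule refl)
qed (simp add: ideal_c_def)

lemma ideal_c_compact: "S \<in> ideal_c p X Y c \<Longrightarrow> S \<in> compact_ops Z Z"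
  by (simp add: ideal_c_def)

lemma ideal_c_bounded: "ideal_c p X Y c \<subseteq> bounded_ops Z Z"
  using compact_bounded[OF ideal_c_compact] by auto

lemma op_subspace_ideal_c:
  assumes c: "c \<in> ell1"
  shows "op_subspace Z (ideal_c p X Y c)"
  unfolding Z.op_subspace_iff
proof (intro conjI ballI allI)
  show "ideal_c p X Y c \<subseteq> bounded_ops Z Z" by (rule ideal_c_bounded)
  have "(0 :: (nat \<Rightarrow> 'a) \<Rightarrow> nat \<Rightarrow> 'a) \<circ> V = 0" for V :: "'a \<Rightarrow> nat \<Rightarrow> 'a"
    by (auto simp: fun_eq_iff)
  then show "0 \<in> ideal_c p X Y c"
    unfolding ideal_c_iff[OF c]
    using compact_zero[OF normed_Z banach_Z] approximable_zero[OF normed_Y normed_Z]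
      approximable_zero[OF normed_X normed_Z] by simp
next
  fix S T assume "S \<in> ideal_c p X Y c" "T \<in> ideal_c p X Y c"
  moreover have "(S + T) \<circ> V = (S \<circ> V) + (T \<circ> V)" for V :: "'a \<Rightarrow> nat \<Rightarrow> 'a" by (auto simp: fun_eq_iff)
  ultimately show "S + T \<in> ideal_c p X Y c"
    unfolding ideal_c_iff[OF c]
    by (simp add: compact_add[OF normed_Z banach_Z] approximable_add[OF normed_Y normed_Z]
        approximable_add[OF normed_X normed_Z])
next
  fix a T assume T: "T \<in> ideal_c p X Y c"
  have "(\<lambda>x. smul Z a (T x)) \<circ> V = (\<lambda>x. smul Z a ((T \<circ> V) x))" for V :: "'a \<Rightarrow> nat \<Rightarrow> 'a"
    by (auto simp: fun_eq_iff)
  then show "(\<lambda>x. smul Z a (T x)) \<in> ideal_c p X Y c"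
    using T compact_scale[OF normed_Z banach_Z, of T a] approximable_scale[OF normed_Y normed_Z, of "T \<circ> incl 0" a]
        approximable_scale[OF normed_X normed_Z, of "T \<circ> spread c" a]
    unfolding ideal_c_iff[OF c] by (simp only: simp_thms)
qed

lemma approximable_comp_limit:
  assumes F: "normed_space F" and T: "T \<in> bounded_ops Z Z" and V: "V \<in> bounded_ops F Z"
    and lim: "\<And>e. e > 0 \<Longrightarrow> \<exists>S. S \<circ> V \<in> approximable_ops F Z \<and> (\<forall>z\<in>pts Z. nrm Z (T z - S z) \<le> e * nrm Z z)"
  shows "T \<circ> V \<in> approximable_ops F Z"
proof (rule approximable_limit[OF F normed_Z bounded_ops_comp[OF F normed_Z T V]])
  fix e :: real assume "e > 0"
  obtain C where C: "C > 0" "\<And>x. x \<in> pts F \<Longrightarrow> nrm Z (V x) \<le> C * nrm F x"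
    using bounded_ops_bound[OF F V] by metis
  have "e / C > 0" using \<open>e > 0\<close> C(1) by simp
  then obtain S where S: "S \<circ> V \<in> approximable_ops F Z"
    "\<And>z. z \<in> pts Z \<Longrightarrow> nrm Z (T z - S z) \<le> e / C * nrm Z z"
    using lim by metis
  have "nrm Z ((T \<circ> V) x - (S \<circ> V) x) \<le> e * nrm F x" if x: "x \<in> pts F" for x
  proof -
    have "nrm Z (T (V x) - S (V x)) \<le> e / C * nrm Z (V x)"
      by (rule S(2)[OF bounded_opsD(1)[OF V x]])
    also have "\<dots> \<le> e / C * (C * nrm F x)"
      using C(2)[OF x] \<open>e / C > 0\<close> by (intro mult_left_mono) auto
    finally show ?thesis using C(1) by simp
  qed
  then show "\<exists>R\<in>approximable_ops F Z. \<forall>x\<in>pts F. nrm Z ((T \<circ> V) x - R x) \<le> e * nrm F x"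
    using S(1) by (intro bexI[of _ "S \<circ> V"]) auto
qed

lemma op_closed_ideal_c:
  assumes c: "c \<in> ell1"
  shows "op_closed Z (ideal_c p X Y c)"
  unfolding op_closed_iff[OF normed_Z]
proof (intro conjI ballI impI)
  show "ideal_c p X Y c \<subseteq> bounded_ops Z Z" by (rule ideal_c_bounded)
  fix T assume T: "T \<in> bounded_ops Z Z"
    and lim: "\<forall>e>0. \<exists>S\<in>ideal_c p X Y c. \<forall>z\<in>pts Z. nrm Z (T z - S z) \<le> e * nrm Z z"
  have near: "\<exists>S. S \<in> compact_ops Z Z \<and> S \<circ> incl 0 \<in> approximable_ops Y Z \<and>
      S \<circ> spread c \<in> approximable_ops X Z \<and> (\<forall>z\<in>pts Z. nrm Z (T z - S z) \<le> e * nrm Z z)"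
    if e: "e > 0" for e
  proof -
    obtain S where "S \<in> ideal_c p X Y c" "\<forall>z\<in>pts Z. nrm Z (T z - S z) \<le> e * nrm Z z"
      using lim[rule_format, OF e] by auto
    then show ?thesis unfolding ideal_c_iff[OF c] by (intro exI[of _ S]) simp
  qed
  have "T \<in> compact_ops Z Z"
    using near by (intro compact_limit[OF normed_Z banach_Z T]) (metis (no_types, lifting))
  moreover have "T \<circ> incl 0 \<in> approximable_ops Y Z"
    using near by (intro approximable_comp_limit[OF normed_Y T incl_0_bounded]) (metis (no_types, lifting))
  moreover have "T \<circ> spread c \<in> approximable_ops X Z"
    using near by (intro approximable_comp_limit[OF normed_X T spread_bounded[OF c]]) (metis (no_types, lifting))
  ultimately show "T \<in> ideal_c p X Y c" by (simp add: ideal_c_iff[OF c])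
qed

lemma left_ideal_of_ideal_c:
  assumes c: "c \<in> ell1" and A: "ideal_c p X Y c \<subseteq> A" "A \<subseteq> bounded_ops Z Z"
  shows "left_ideal_of Z A (ideal_c p X Y c)"
  unfolding left_ideal_of_def
proof (intro conjI ballI A(1) op_subspace_ideal_c[OF c])
  fix U S assume "U \<in> A" and S: "S \<in> ideal_c p X Y c"
  then have U: "U \<in> bounded_ops Z Z" using A(2) by auto
  show "U \<circ> S \<in> ideal_c p X Y c"
    using S compact_comp_left[OF normed_Z banach_Z banach_Z U]
      approximable_comp_left[OF normed_Y normed_Z normed_Z U]
      approximable_comp_left[OF normed_X normed_Z normed_Z U]
    by (simp add: ideal_c_iff[OF c] comp_assoc)
qed

text \<open>Split \<open>W = J\<^sub>0 P\<^sub>0 W + (W - J\<^sub>0 P\<^sub>0 W)\<close>: the first part is absorbed by the hypothesis on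
  \<open>S J\<^sub>0\<close>, and the second, being compact with zeroth coordinate \<open>0\<close>, is itself approximable.\<close>

lemma comp_compact_approximable:
  assumes F: "normed_space F" and S: "S \<in> bounded_ops Z Z" "S \<circ> incl 0 \<in> approximable_ops Y Z"
    and W: "W \<in> compact_ops F Z"
  shows "S \<circ> W \<in> approximable_ops F Z"
proof -
  let ?V = "incl 0 \<circ> (proj 0 \<circ> W)"
  define D where "D = W + (\<lambda>x. smul Z (-1) (?V x))"
  have Wb: "W \<in> bounded_ops F Z" by (rule compact_bounded[OF W])
  have PW: "proj 0 \<circ> W \<in> compact_ops F Y"
    by (rule compact_comp_left[OF F banach_Z banach_Y proj_0_bounded W])
  have V: "?V \<in> compact_ops F Z"
    by (rule compact_comp_left[OF F banach_Y banach_Z incl_0_bounded PW])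
  have D: "D \<in> compact_ops F Z"
    unfolding D_def by (intro compact_add[OF F banach_Z] compact_scale[OF F banach_Z] W V)
  have D_eq: "D x = W x - ?V x" for x by (simp add: D_def)
  have "proj 0 \<circ> D = 0"
  proof (rule bounded_ops_eqI)
    show "proj 0 \<circ> D \<in> bounded_ops F Y"
      by (rule bounded_ops_comp[OF F normed_Z proj_0_bounded compact_bounded[OF D]])
    show "0 \<in> bounded_ops F Y" by (rule subspace_bounded_ops(1)[OF F normed_Y])
    fix x assume x: "x \<in> pts F"
    have w: "W x \<in> pts Z" "D x \<in> pts Z"
      using bounded_opsD(1)[OF Wb x] bounded_opsD(1)[OF compact_bounded[OF D] x] by auto
    have "W x 0 \<in> pts Y" using pts_coord[of "W x" 0] w by (simp add: Zp_eq)
    then have "D x 0 = 0"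
      using w unfolding D_eq by (simp add: proj_def incl_def coord_incl_def Zp_eq)
    then show "(proj 0 \<circ> D) x = 0 x" by (simp add: proj_def)
  qed
  then have "D \<in> approximable_ops F Z"
    using approximable_iff_coord_0[OF F D] approximable_zero[OF F normed_Y] by simp
  then have "S \<circ> D \<in> approximable_ops F Z"
    by (rule approximable_comp_left[OF F normed_Z normed_Z S(1)])
  moreover have "(S \<circ> incl 0) \<circ> (proj 0 \<circ> W) \<in> approximable_ops F Z"
    by (rule approximable_comp_right[OF F normed_Y normed_Z S(2) compact_bounded[OF PW]])
  moreover have "S \<circ> W = ((S \<circ> incl 0) \<circ> (proj 0 \<circ> W)) + (S \<circ> D)"
  proof (rule bounded_ops_eqI)
    show "S \<circ> W \<in> bounded_ops F Z" by (rule bounded_ops_comp[OF F normed_Z S(1) Wb])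
    show "((S \<circ> incl 0) \<circ> (proj 0 \<circ> W)) + (S \<circ> D) \<in> bounded_ops F Z"
      using calculation by (intro subspace_bounded_ops(2)[OF F normed_Z] approximable_bounded[OF F normed_Z])
    fix x assume x: "x \<in> pts F"
    have "S (?V x + D x) = S (?V x) + S (D x)"
      by (intro bounded_opsD(2)[OF S(1)] bounded_opsD(1)[OF compact_bounded[OF V] x]
          bounded_opsD(1)[OF compact_bounded[OF D] x])
    then show "(S \<circ> W) x = (((S \<circ> incl 0) \<circ> (proj 0 \<circ> W)) + (S \<circ> D)) x"
      by (simp add: D_eq)
  qed
  ultimately show ?thesis using approximable_add[OF F normed_Z] by simp
qed

lemma ideal_of_compact_ops_ideal_c:
  assumes c: "c \<in> ell1"
  shows "ideal_of Z (compact_ops Z Z) (ideal_c p X Y c)"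
  unfolding ideal_of_def
proof
  have K: "ideal_c p X Y c \<subseteq> compact_ops Z Z" using ideal_c_compact by auto
  show "left_ideal_of Z (compact_ops Z Z) (ideal_c p X Y c)"
    using K compact_bounded by (intro left_ideal_of_ideal_c[OF c]) auto
  show "right_ideal_of Z (compact_ops Z Z) (ideal_c p X Y c)"
    unfolding right_ideal_of_def
  proof (intro conjI ballI K op_subspace_ideal_c[OF c])
    fix U S assume U: "U \<in> compact_ops Z Z" and "S \<in> ideal_c p X Y c"
    then have S: "S \<in> compact_ops Z Z" "S \<circ> incl 0 \<in> approximable_ops Y Z"
      by (auto simp: ideal_c_iff[OF c])
    note comp = comp_compact_approximable[OF _ compact_bounded[OF S(1)] S(2)]
    show "S \<circ> U \<in> ideal_c p X Y c"
      unfolding ideal_c_iff[OF c] comp_assoc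
    proof (intro conjI)
      show "S \<circ> U \<in> compact_ops Z Z"
        by (rule compact_comp_left[OF normed_Z banach_Z banach_Z compact_bounded[OF S(1)] U])
      show "S \<circ> (U \<circ> incl 0) \<in> approximable_ops Y Z"
        by (intro comp normed_Y compact_comp_right[OF normed_Y normed_Z banach_Z U incl_0_bounded])
      show "S \<circ> (U \<circ> spread c) \<in> approximable_ops X Z"
        by (intro comp normed_X compact_comp_right[OF normed_X normed_Z banach_Z U spread_bounded[OF c]])
    qed
  qed
qed

lemma closed_subideal_ideal_c:
  assumes c: "c \<in> ell1"
  shows "closed_subideal Z (compact_ops Z Z) (ideal_c p X Y c)"
proof -
  have K: "ideal_c p X Y c \<subseteq> compact_ops Z Z" using ideal_c_compact by auto
  note ideal = ideal_of_compact_ops_ideal_c[OF c]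
  have "S \<circ> T \<in> ideal_c p X Y c" if "S \<in> ideal_c p X Y c" "T \<in> ideal_c p X Y c" for S T
    using ideal that ideal_c_compact[OF that(1)] unfolding ideal_of_def left_ideal_of_def by simp
  then have "closed_subalgebra Z (ideal_c p X Y c)"
    unfolding closed_subalgebra_def using op_subspace_ideal_c[OF c] op_closed_ideal_c[OF c] by simp
  then show ?thesis
    unfolding closed_subideal_def
    using Z.closed_subalgebra_compact_ops Z.compact_ops_ideal K ideal by simp
qed


section \<open>Operators that separate the ideals\<close>

text \<open>The operators \<open>J\<^sub>0 T (a P\<^sub>r + b P\<^sub>s)\<close> serve as test elements: membership in \<open>\<I>(c)\<close> becomes a
  linear equation between \<open>c\<^sub>r\<close> and \<open>c\<^sub>s\<close>, and two coordinates are the fewest that admit a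
  cancellation.\<close>

definition combine :: "nat \<Rightarrow> 'k \<Rightarrow> nat \<Rightarrow> 'k \<Rightarrow> (nat \<Rightarrow> 'a) \<Rightarrow> 'a" where
  "combine r a s b = (scalar_op X a \<circ> proj r) + (scalar_op X b \<circ> proj s)"

definition row_op :: "('a \<Rightarrow> 'a) \<Rightarrow> nat \<Rightarrow> 'k \<Rightarrow> nat \<Rightarrow> 'k \<Rightarrow> (nat \<Rightarrow> 'a) \<Rightarrow> nat \<Rightarrow> 'a" where
  "row_op T r a s b = incl 0 \<circ> (T \<circ> combine r a s b)"

lemma combine_bounded:
  assumes "r \<noteq> 0" "s \<noteq> 0"
  shows "combine r a s b \<in> bounded_ops Z X"
  unfolding combine_def
  by (intro subspace_bounded_ops(2)[OF normed_Z normed_X] bounded_ops_comp[OF normed_Z normed_X]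
      scalar_op_bounded normed_X proj_bounded_X assms)

lemma combine_eq:
  assumes "r \<noteq> 0" "s \<noteq> 0" "z \<in> pts Z"
  shows "combine r a s b z = smul X a (z r) + smul X b (z s)"
  using assms pts_coord[of z r] pts_coord[of z s] by (simp add: combine_def scalar_op_def proj_def Zp_eq)

lemma row_op_compact:
  assumes "T \<in> compact_ops X Y" "r \<noteq> 0" "s \<noteq> 0"
  shows "row_op T r a s b \<in> compact_ops Z Z"
  unfolding row_op_def
  by (intro compact_comp_left[OF normed_Z banach_Y banach_Z incl_0_bounded]
      compact_comp_right[OF normed_Z normed_X banach_Y assms(1)] combine_bounded assms)

lemma proj_row_op_comp:
  assumes T: "T \<in> bounded_ops X Y" and rs: "r \<noteq> 0" "s \<noteq> 0" and V: "V \<in> bounded_ops X Z"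
    and V_eq: "\<And>x. x \<in> pts X \<Longrightarrow> smul X a (V x r) + smul X b (V x s) = smul X l x"
  shows "proj 0 \<circ> (row_op T r a s b \<circ> V) = (\<lambda>x. smul Y l (T x))"
proof (rule bounded_ops_eqI)
  show "proj 0 \<circ> (row_op T r a s b \<circ> V) \<in> bounded_ops X Y"
    unfolding row_op_def
    by (intro bounded_ops_comp[OF normed_X normed_Z proj_0_bounded]
        bounded_ops_comp[OF normed_X normed_Z _ V] bounded_ops_comp[OF normed_Z normed_Y incl_0_bounded]
        bounded_ops_comp[OF normed_Z normed_X T] combine_bounded rs)
  show "(\<lambda>x. smul Y l (T x)) \<in> bounded_ops X Y" by (rule subspace_bounded_ops(3)[OF normed_X normed_Y T])
  fix x assume x: "x \<in> pts X"
  have y: "smul Y l (T x) \<in> pts Y" by (intro Y.pts_smul bounded_opsD(1)[OF T x])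
  have "T (combine r a s b (V x)) = smul Y l (T x)"
    using V_eq[OF x] combine_eq[OF rs bounded_opsD(1)[OF V x]] bounded_opsD(3)[OF T x] by simp
  then show "(proj 0 \<circ> (row_op T r a s b \<circ> V)) x = smul Y l (T x)"
    using y bounded_opsD(1)[OF incl_0_bounded y]
    by (simp add: row_op_def proj_def incl_def coord_incl_def Zp_eq)
qed

lemma scaled_approximable_iff:
  assumes "T \<notin> approximable_ops X Y"
  shows "(\<lambda>x. smul Y l (T x)) \<in> approximable_ops X Y \<longleftrightarrow> l = 0"
proof
  assume *: "(\<lambda>x. smul Y l (T x)) \<in> approximable_ops X Y"
  show "l = 0"
  proof (rule ccontr)
    assume "l \<noteq> 0"
    then have "T = (\<lambda>x. smul Y (inverse l) (smul Y l (T x)))" by simp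
    then show False using approximable_scale[OF normed_X normed_Y *, of "inverse l"] assms by simp
  qed
next
  assume "l = 0"
  then have "(\<lambda>x. smul Y l (T x)) = 0" by (auto simp: fun_eq_iff)
  then show "(\<lambda>x. smul Y l (T x)) \<in> approximable_ops X Y"
    using approximable_zero[OF normed_X normed_Y] by simp
qed

lemma proj_row_op_incl_0:
  assumes "T \<in> bounded_ops X Y" "r \<noteq> 0" "s \<noteq> 0"
  shows "proj 0 \<circ> (row_op T r a s b \<circ> incl 0) \<in> approximable_ops Y Y"
proof -
  have "row_op T r a s b \<circ> incl 0 = 0"
  proof
    fix y
    have "incl 0 y \<in> pts Z"
      using bounded_opsD(1)[OF incl_0_bounded, of y] by (cases "y \<in> pts Y") (simp_all add: incl_def)
    then have "combine r a s b (incl 0 y) = smul X a (incl 0 y r) + smul X b (incl 0 y s)"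
      by (rule combine_eq[OF assms(2,3)])
    also have "\<dots> = 0" using assms(2,3) by (simp add: incl_def coord_incl_def)
    finally show "(row_op T r a s b \<circ> incl 0) y = 0 y"
      using bounded_ops_zero[OF normed_X assms(1)] bounded_ops_zero[OF normed_Y incl_0_bounded]
      by (simp add: row_op_def)
  qed
  moreover have "proj 0 \<circ> 0 = (0 :: 'a \<Rightarrow> 'a)"
    using bounded_ops_zero[OF normed_Z proj_0_bounded] by (intro ext) (simp only: comp_apply zero_fun_apply)
  ultimately show ?thesis using approximable_zero[OF normed_Y normed_Y] by (simp only:)
qed

context
  fixes T
  assumes T_compact: "T \<in> compact_ops X Y" and T_not_approximable: "T \<notin> approximable_ops X Y"
begin

lemma row_op_in_ideal_c_iff:
  assumes c: "c \<in> ell1" and rs: "r \<noteq> 0" "s \<noteq> 0"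
  shows "row_op T r a s b \<in> ideal_c p X Y c \<longleftrightarrow> a * c r + b * c s = 0"
proof -
  have "proj 0 \<circ> (row_op T r a s b \<circ> spread c) = (\<lambda>x. smul Y (a * c r + b * c s) (T x))"
    by (rule proj_row_op_comp[OF compact_bounded[OF T_compact] rs spread_bounded[OF c]])
      (simp add: spread_def X.scale_left_distrib)
  then show ?thesis
    unfolding ideal_c_iff_row[OF c]
    using row_op_compact[OF T_compact rs] proj_row_op_incl_0[OF compact_bounded[OF T_compact] rs]
      scaled_approximable_iff[OF T_not_approximable] by simp
qed

lemma row_op_in_ideal_B_iff:
  assumes B: "B \<subseteq> {1..}" and rs: "r \<noteq> 0" "s \<noteq> 0"
  shows "row_op T r a s b \<in> ideal_B p X Y B \<longleftrightarrow>
    (\<forall>k\<in>B. (if k = r then a else 0) + (if k = s then b else 0) = 0)"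
proof -
  let ?S = "row_op T r a s b"
  have S: "?S \<in> bounded_ops Z Z" by (rule compact_bounded[OF row_op_compact[OF T_compact rs]])
  have e: "entry ?S 0 k = proj 0 \<circ> (?S \<circ> incl k)" for k
    using entry_eq[of ?S 0 k] S by (simp add: Zp_eq comp_assoc)
  have "entry ?S 0 k \<in> approximable_ops X Y \<longleftrightarrow> (if k = r then a else 0) + (if k = s then b else 0) = 0"
    if "k \<in> B" for k
  proof -
    have k: "k \<noteq> 0" using B that by auto
    have "entry ?S 0 k = (\<lambda>x. smul Y ((if k = r then a else 0) + (if k = s then b else 0)) (T x))"
      unfolding e
      by (rule proj_row_op_comp[OF compact_bounded[OF T_compact] rs incl_bounded_X[OF k]])
        (use k in \<open>auto simp: incl_def coord_incl_def X.scale_left_distrib\<close>)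
    then show ?thesis using scaled_approximable_iff[OF T_not_approximable] by simp
  qed
  moreover have "entry ?S 0 0 \<in> approximable_ops Y Y"
    unfolding e by (rule proj_row_op_incl_0[OF compact_bounded[OF T_compact] rs])
  ultimately show ?thesis using row_op_compact[OF T_compact rs] by (simp add: ideal_B_def)
qed

text \<open>The operator \<open>J\<^sub>0 T (c\<^sub>s P\<^sub>r - c\<^sub>r P\<^sub>s)\<close> belongs to \<open>\<I>(c)\<close> through a cancellation of two
  non-approximable terms; composing with \<open>J\<^sub>r P\<^sub>r\<close> on the right leaves only one of them.\<close>

lemma ideal_c_not_right_ideal:
  assumes c: "c \<in> ell1" and rs: "r \<noteq> s" "r \<in> supp c" "s \<in> supp c"
  shows "\<not> right_ideal_of Z (bounded_ops Z Z) (ideal_c p X Y c)"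
proof
  assume right: "right_ideal_of Z (bounded_ops Z Z) (ideal_c p X Y c)"
  have nz: "r \<noteq> 0" "s \<noteq> 0" "c r \<noteq> 0" "c s \<noteq> 0" using rs by (auto simp: supp_def)
  let ?S = "row_op T r (c s) s (- c r)" and ?U = "incl r \<circ> proj r"
  have U: "?U \<in> bounded_ops Z Z"
    by (rule bounded_ops_comp[OF normed_Z normed_X incl_bounded_X proj_bounded_X]) (use nz in auto)
  have "?S \<in> ideal_c p X Y c"
    unfolding row_op_in_ideal_c_iff[OF c nz(1,2)] by simp
  then have "?S \<circ> ?U \<in> ideal_c p X Y c"
    using right U unfolding right_ideal_of_def by simp
  then have A: "proj 0 \<circ> (?S \<circ> (?U \<circ> spread c)) \<in> approximable_ops X Y"
    by (simp add: ideal_c_iff_row[OF c] comp_assoc)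
  have V: "?U \<circ> spread c \<in> bounded_ops X Z"
    by (rule bounded_ops_comp[OF normed_X normed_Z U spread_bounded[OF c]])
  have "proj 0 \<circ> (?S \<circ> (?U \<circ> spread c)) = (\<lambda>x. smul Y (c s * c r) (T x))"
  proof (rule proj_row_op_comp[OF compact_bounded[OF T_compact] nz(1,2) V])
    fix x assume x: "x \<in> pts X"
    have "proj r (spread c x) = smul X (c r) x"
      using bounded_opsD(1)[OF spread_bounded[OF c] x] x by (simp add: proj_def spread_def Zp_eq)
    then have "(?U \<circ> spread c) x = coord_incl r (smul X (c r) x)"
      using nz X.pts_smul[OF x] by (simp add: incl_def)
    then show "smul X (c s) ((?U \<circ> spread c) x r) + smul X (- c r) ((?U \<circ> spread c) x s) =
        smul X (c s * c r) x"
      using rs(1) by (simp add: coord_incl_def)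
  qed
  then show False using A scaled_approximable_iff[OF T_not_approximable] nz by simp
qed

text \<open>Since \<open>J\<^sub>0 T P\<^sub>r\<close> is not in \<open>\<I>(c)\<close>, equality would put \<open>r\<close> into \<open>B\<close>. But
  \<open>J\<^sub>0 T (c\<^sub>s P\<^sub>r - c\<^sub>r P\<^sub>s)\<close>, which is in \<open>\<I>(c)\<close> by cancellation, has the non-approximable entry
  \<open>c\<^sub>s T\<close> at \<open>r\<close>.\<close>

lemma ideal_c_neq_ideal_B:
  assumes c: "c \<in> ell1" and rs: "r \<noteq> s" "r \<in> supp c" "s \<in> supp c" and B: "B \<subseteq> {1..}"
  shows "ideal_c p X Y c \<noteq> ideal_B p X Y B"
proof
  assume eq: "ideal_c p X Y c = ideal_B p X Y B"
  have nz: "r \<noteq> 0" "s \<noteq> 0" "c r \<noteq> 0" "c s \<noteq> 0" using rs by (auto simp: supp_def)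
  have "r \<in> B"
  proof (rule ccontr)
    assume "r \<notin> B"
    then have "row_op T r 1 r 0 \<in> ideal_B p X Y B"
      unfolding row_op_in_ideal_B_iff[OF B nz(1,1)] by auto
    then show False using row_op_in_ideal_c_iff[OF c nz(1,1), of 1 0] eq nz by simp
  qed
  have "row_op T r (c s) s (- c r) \<in> ideal_B p X Y B"
    unfolding eq[symmetric] row_op_in_ideal_c_iff[OF c nz(1,2)] by simp
  then show False
    unfolding row_op_in_ideal_B_iff[OF B nz(1,2)] using \<open>r \<in> B\<close> rs(1) nz by auto
qed

text \<open>The ideal determines the annihilator of \<open>c\<close> among the functionals supported on two
  coordinates, hence determines \<open>c\<close> up to a factor.\<close>

lemma ideal_c_eq_iff:
  assumes c: "c \<in> ell1" "c \<noteq> (\<lambda>_. 0)" and d: "d \<in> ell1" "d \<noteq> (\<lambda>_. 0)"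
  shows "ideal_c p X Y c = ideal_c p X Y d \<longleftrightarrow> (\<exists>l. l \<noteq> 0 \<and> c = (\<lambda>j. l * d j))"
proof
  assume eq: "ideal_c p X Y c = ideal_c p X Y d"
  obtain s where s: "d s \<noteq> 0" using d(2) by (auto simp: fun_eq_iff)
  have s0: "s \<noteq> 0" using s d(1) by (cases "s = 0") (simp_all add: ell1_def)
  have factor: "c r = c s / d s * d r" for r
  proof (cases "r = 0")
    case True
    then show ?thesis using c(1) d(1) by (simp add: ell1_def)
  next
    case False
    have "row_op T r (d s) s (- d r) \<in> ideal_c p X Y c"
      unfolding eq row_op_in_ideal_c_iff[OF d(1) False s0] by simp
    then have "d s * c r = d r * c s" unfolding row_op_in_ideal_c_iff[OF c(1) False s0] by simp
    then show ?thesis using s by (simp add: field_simps)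
  qed
  then have *: "c = (\<lambda>j. c s / d s * d j)" by (rule ext)
  have "c s / d s \<noteq> 0"
  proof
    assume zero: "c s / d s = 0"
    have "c r = 0" for r by (subst factor) (simp only: zero mult_zero_left)
    then have "c = (\<lambda>_. 0)" by (rule ext)
    then show False using c(2) by simp
  qed
  then show "\<exists>l. l \<noteq> 0 \<and> c = (\<lambda>j. l * d j)" using * by (intro exI[of _ "c s / d s"]) simp
next
  assume "\<exists>l. l \<noteq> 0 \<and> c = (\<lambda>j. l * d j)"
  then obtain l where l: "l \<noteq> 0" "c = (\<lambda>j. l * d j)" by auto
  have sp: "spread c x = smul Z l (spread d x)" for x
    using d(1) by (auto simp: l(2) spread_def Zp_eq smul_lp_sum fun_eq_iff ell1_def)
  have pts: "spread d x \<in> pts Z" for x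
    using bounded_opsD(1,4)[OF spread_bounded[OF d(1)], of x] by (cases "x \<in> pts X") auto
  have scaled: "S \<circ> spread c = (\<lambda>x. smul Z l ((S \<circ> spread d) x))" if "S \<in> bounded_ops Z Z" for S
    using bounded_opsD(3)[OF that pts] by (auto simp: sp fun_eq_iff)
  have "S \<circ> spread c \<in> approximable_ops X Z \<longleftrightarrow> S \<circ> spread d \<in> approximable_ops X Z"
    if "S \<in> compact_ops Z Z" for S
  proof
    have "S \<circ> spread d = (\<lambda>x. smul Z (inverse l) ((S \<circ> spread c) x))"
      unfolding scaled[OF compact_bounded[OF that]] using l(1) by (intro ext) simp
    moreover assume "S \<circ> spread c \<in> approximable_ops X Z"
    ultimately show "S \<circ> spread d \<in> approximable_ops X Z"
      using approximable_scale[OF normed_X normed_Z, of "S \<circ> spread c" "inverse l"] by (simp only:)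
  next
    assume "S \<circ> spread d \<in> approximable_ops X Z"
    then show "S \<circ> spread c \<in> approximable_ops X Z"
      using approximable_scale[OF normed_X normed_Z, of "S \<circ> spread d" l]
        scaled[OF compact_bounded[OF that]] by (simp only:)
  qed
  then show "ideal_c p X Y c = ideal_c p X Y d"
    unfolding set_eq_iff ideal_c_iff[OF c(1)] ideal_c_iff[OF d(1)] by (simp cong: conj_cong)
qed

end

end

lemma two_supportedE:
  assumes "two_supported c"
  obtains r s where "r \<noteq> s" "r \<in> supp c" "s \<in> supp c"
proof -
  have "\<not> (\<exists>x. supp c \<subseteq> {x})"
  proof
    assume "\<exists>x. supp c \<subseteq> {x}"
    then obtain x where "supp c \<subseteq> {x}" by auto
    then have "finite (supp c)" "card (supp c) \<le> 1"
      using finite_subset card_mono[of "{x}" "supp c"] by auto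
    then show False using assms by (simp add: two_supported_def)
  qed
  moreover from this obtain r where "r \<in> supp c" by blast
  ultimately show thesis using that by blast
qed


section \<open>The number of ideals\<close>

text \<open>A sequence is coded by the pairs \<open>(n, m)\<close> for which its \<open>n\<close>-th term lies in the \<open>m\<close>-th basic
  open set; the code is a set of natural numbers.\<close>

lemma sequences_lepoll_reals:
  "(UNIV :: (nat \<Rightarrow> 'b::{second_countable_topology,t1_space}) set) \<lesssim> (UNIV :: real set)"
proof -
  obtain \<B> :: "'b set set" where B: "countable \<B>" "topological_basis \<B>"
    using ex_countable_basis by auto
  define code where "code f = {prod_encode (n, m) |n m. f n \<in> from_nat_into \<B> m}" for f :: "nat \<Rightarrow> 'b"
  have "inj code"
  proof (rule injI, rule ext, rule ccontr)
    fix f g n assume eq: "code f = code g" and "f n \<noteq> g n"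
    then obtain U where U: "open U" "f n \<in> U" "g n \<notin> U" using t1_space by metis
    obtain b where b: "b \<in> \<B>" "f n \<in> b" "b \<subseteq> U" using topological_basisE[OF B(2) U(1,2)] .
    obtain m where m: "from_nat_into \<B> m = b" using from_nat_into_surj[OF B(1) b(1)] ..
    have "prod_encode (n, m) \<in> code f" using b m by (auto simp: code_def)
    then have "g n \<in> b" using m unfolding eq by (auto simp: code_def)
    then show False using U(3) b(3) by auto
  qed
  then have "(UNIV :: (nat \<Rightarrow> 'b) set) \<lesssim> (UNIV :: nat set set)" by (auto simp: lepoll_def)
  then show ?thesis using nat_sets_eqpoll_reals lepoll_trans2 by metis
qed

lemma (in zp_space) family_F_plus_eqpoll_reals:
  assumes T: "T \<in> compact_ops X Y" "T \<notin> approximable_ops X Y"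
  shows "family_F_plus p X Y \<approx> (UNIV :: real set)"
proof (rule lepoll_antisym)
  have "family_F_plus p X Y \<subseteq> range (ideal_c p X Y)" by (auto simp: family_F_plus_def)
  then have "family_F_plus p X Y \<lesssim> range (ideal_c p X Y)" by (rule subset_imp_lepoll)
  also have "\<dots> \<lesssim> (UNIV :: (nat \<Rightarrow> 'k) set)" by (rule image_lepoll)
  also have "\<dots> \<lesssim> (UNIV :: real set)" by (rule sequences_lepoll_reals)
  finally show "family_F_plus p X Y \<lesssim> (UNIV :: real set)" .
next
  define c :: "real \<Rightarrow> nat \<Rightarrow> 'k" where
    "c t = (\<lambda>j. if j = 1 then 1 else if j = 2 then of_real (exp t) else 0)" for t
  have ell1: "c t \<in> ell1" for t
  proof -
    have "summable (\<lambda>j. norm (c t j))" by (rule summable_finite[of "{1, 2}"]) (auto simp: c_def)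
    then show ?thesis by (simp add: ell1_def c_def)
  qed
  have supp: "supp (c t) = {1, 2}" for t by (auto simp: supp_def c_def)
  have nz: "c t \<noteq> (\<lambda>_. 0)" for t
  proof
    assume "c t = (\<lambda>_. 0)"
    then have "c t 1 = 0" by simp
    then show False by (simp add: c_def)
  qed
  have "inj (\<lambda>t. ideal_c p X Y (c t))"
  proof (rule injI)
    fix t u assume "ideal_c p X Y (c t) = ideal_c p X Y (c u)"
    then obtain l where l: "c t = (\<lambda>j. l * c u j)"
      using ideal_c_eq_iff[OF T ell1 nz ell1 nz] by auto
    have "l = 1" using fun_cong[OF l, of 1] by (simp add: c_def)
    then show "t = u" using fun_cong[OF l, of 2] by (simp add: c_def)
  qed
  moreover have "range (\<lambda>t. ideal_c p X Y (c t)) \<subseteq> family_F_plus p X Y"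
    using ell1 supp by (auto simp: family_F_plus_def two_supported_def)
  ultimately show "(UNIV :: real set) \<lesssim> family_F_plus p X Y" by (auto simp: lepoll_def)
qed

theorem theorem3p1:
  fixes X Y :: "('k::{real_normed_field,euclidean_space}, 'a::ab_group_add) nspace"
    and p :: real
  defines "Z \<equiv> Zp p X Y"
  assumes "banach_space X" and "banach_space Y"
    and "approximation_property X"
    and "\<not> approximation_property (dual_space X)"
    and "approximable_ops X Y \<subset> compact_ops X Y"
    and "1 < p"
  shows
    "(\<forall>c \<in> (ell1 :: (nat \<Rightarrow> 'k) set). c \<noteq> (\<lambda>_. 0) \<and> two_supported c \<longrightarrow>
        (op_closed Z (ideal_c p X Y c) \<and>
         ideal_of Z (compact_ops Z Z) (ideal_c p X Y c) \<and>
         left_ideal_of Z (bounded_ops Z Z) (ideal_c p X Y c)) \<and>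
        (\<not> right_ideal_of Z (bounded_ops Z Z) (ideal_c p X Y c) \<and>
         nontrivial_closed_subideal Z (compact_ops Z Z) (ideal_c p X Y c)) \<and>
        (\<forall>B. B \<noteq> {} \<and> B \<subset> {1..} \<longrightarrow> ideal_c p X Y c \<noteq> ideal_B p X Y B) \<and>
        (\<forall>d \<in> ell1. d \<noteq> (\<lambda>_. 0) \<and> supp d \<noteq> supp c \<longrightarrow>
           ideal_c p X Y d \<noteq> ideal_c p X Y c) \<and>
        (\<forall>d \<in> ell1. d \<noteq> (\<lambda>_. 0) \<longrightarrow>
           (ideal_c p X Y c = ideal_c p X Y d \<longleftrightarrow>
            (\<exists>l. l \<noteq> 0 \<and> c = (\<lambda>j. l * d j))))) \<and>
     (\<forall>J \<in> family_F_plus p X Y. nontrivial_closed_subideal Z (compact_ops Z Z) J) \<and>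
     family_F_plus p X Y \<approx> (UNIV :: real set) \<and>
     family_F_plus p X Y \<inter> family_F p X Y = {}"
proof -
  interpret zp_space X Y p
    using assms(2-4,7) by (intro zp_space.intro) simp_all
  obtain T where T: "T \<in> compact_ops X Y" "T \<notin> approximable_ops X Y"
    using assms(6) by auto
  have not_right: "\<not> right_ideal_of Z (bounded_ops Z Z) (ideal_c p X Y c)"
    if c: "c \<in> ell1" and two: "two_supported c" for c
    using two_supportedE[OF two] ideal_c_not_right_ideal[OF T c] unfolding Z_def by metis
  have subideal: "nontrivial_closed_subideal Z (compact_ops Z Z) (ideal_c p X Y c)"
    if c: "c \<in> ell1" and two: "two_supported c" for c
    using closed_subideal_ideal_c[OF c] not_right[OF c two]
    unfolding nontrivial_closed_subideal_def ideal_of_def Z_def by simp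
  have neq_B: "ideal_c p X Y c \<noteq> ideal_B p X Y B"
    if c: "c \<in> ell1" and two: "two_supported c" and B: "B \<subset> {1..}" for c B
    using two_supportedE[OF two] ideal_c_neq_ideal_B[OF T c _ _ _ psubset_imp_subset[OF B]] by metis
  have neq_supp: "ideal_c p X Y d \<noteq> ideal_c p X Y c"
    if c: "c \<in> ell1" "c \<noteq> (\<lambda>_. 0)" and d: "d \<in> ell1" "d \<noteq> (\<lambda>_. 0)" "supp d \<noteq> supp c" for c d
  proof
    assume "ideal_c p X Y d = ideal_c p X Y c"
    then obtain l where "l \<noteq> 0" "d = (\<lambda>j. l * c j)"
      using ideal_c_eq_iff[OF T d(1,2) c] by auto
    then show False using d(3) by (simp add: supp_def)
  qed
  have left: "left_ideal_of Z (bounded_ops Z Z) (ideal_c p X Y c)" if c: "c \<in> ell1" for c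
    unfolding Z_def by (intro left_ideal_of_ideal_c[OF c] ideal_c_bounded order_refl)
  have F_plus: "\<exists>c. J = ideal_c p X Y c \<and> c \<in> ell1 \<and> two_supported c"
    if "J \<in> family_F_plus p X Y" for J
    using that by (simp add: family_F_plus_def)
  show ?thesis
  proof (intro conjI ballI impI)
    fix c :: "nat \<Rightarrow> 'k" assume c: "c \<in> ell1" and *: "c \<noteq> (\<lambda>_. 0) \<and> two_supported c"
    then have two: "two_supported c" and nz: "c \<noteq> (\<lambda>_. 0)" by auto
    show "op_closed Z (ideal_c p X Y c)" unfolding Z_def by (rule op_closed_ideal_c[OF c])
    show "ideal_of Z (compact_ops Z Z) (ideal_c p X Y c)"
      unfolding Z_def by (rule ideal_of_compact_ops_ideal_c[OF c])
    show "left_ideal_of Z (bounded_ops Z Z) (ideal_c p X Y c)" by (rule left[OF c])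
    show "\<not> right_ideal_of Z (bounded_ops Z Z) (ideal_c p X Y c)" by (rule not_right[OF c two])
    show "nontrivial_closed_subideal Z (compact_ops Z Z) (ideal_c p X Y c)" by (rule subideal[OF c two])
    show "\<forall>B. B \<noteq> {} \<and> B \<subset> {1..} \<longrightarrow> ideal_c p X Y c \<noteq> ideal_B p X Y B"
      using neq_B[OF c two] by simp
    fix d :: "nat \<Rightarrow> 'k" assume d: "d \<in> ell1"
    show "ideal_c p X Y d \<noteq> ideal_c p X Y c" if "d \<noteq> (\<lambda>_. 0) \<and> supp d \<noteq> supp c"
      using that by (intro neq_supp[OF c nz d]) auto
    show "ideal_c p X Y c = ideal_c p X Y d \<longleftrightarrow> (\<exists>l. l \<noteq> 0 \<and> c = (\<lambda>j. l * d j))"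
      if "d \<noteq> (\<lambda>_. 0)" by (rule ideal_c_eq_iff[OF T c nz d that])
  next
    fix J assume "J \<in> family_F_plus p X Y"
    then show "nontrivial_closed_subideal Z (compact_ops Z Z) J" using F_plus subideal by auto
  next
    show "family_F_plus p X Y \<approx> (UNIV :: real set)" by (rule family_F_plus_eqpoll_reals[OF T])
    show "family_F_plus p X Y \<inter> family_F p X Y = {}"
    proof (rule equals0I)
      fix J assume J: "J \<in> family_F_plus p X Y \<inter> family_F p X Y"
      then obtain c where c: "J = ideal_c p X Y c" "c \<in> ell1" "two_supported c" using F_plus by auto
      obtain B where B: "J = ideal_B p X Y B" "B \<subset> {1..}" using J unfolding family_F_def by blast
      show False using neq_B[OF c(2,3) B(2)] c(1) B(1) by (simp only:)
    qed
  qed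
qed

end
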